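(* Let $0<\delta<2\sqrt{6t^*}$. For all sufficiently small $\varepsilon>0$, the function $$u=v^\varepsilon\Big(\eta(d(x,t))+\frac{\delta}{4t^*}t\Big)$$ is a viscosity supersolution on $\mathbb{R}^n\times(0,t^* )$ of $$u_t=-u\times\Big(u\times\big(\Delta u-\tfrac1{\varepsilon^2}H(u)\big)\Big),\qquad u\in S^2.$$
   Context: Constants: $\alpha,\beta\in\mathbb{R}$ with $\alpha+\beta>0$, $\beta>0$; $\varepsilon>0$ is a small parameter. $S^2$ is the unit sphere in $\mathbb{R}^3$, $\times$ is the cross product, and $H(u)=(\alpha u_1u_3^2,\ \alpha u_2u_3^2,\ \alpha u_1^2u_3+\alpha u_2^2u_3+\beta u_3)$. Mean curvature evolution and signed distance. $\Omega\subset\mathbb{R}^n$ is a bounded domain with $C^3$ boundary. $h:\mathbb{R}^n\to\mathbb{R}$ is continuous, smooth with $|\nabla h|=1$ near $\partial\Omega$, constant outside some ball, with $h>0$ in $\Omega$, $h=0$ on $\partial\Omega$, $h<0$ in $\mathbb{R}^n\setminus\overline\Omega$. $w\in C(\mathbb{R}^n\times[0,\infty))$ is the unique weak (viscosity, in the sense of Evans-Spruck) solution of $w_t=\big(\delta_{ij}-\frac{w_{x_i}w_{x_j}}{|\nabla w|^2}\big)w_{x_ix_j}$ in $\mathbb{R}^n\times(0,\infty)$ (here $\delta_{ij}$ is the Kronecker symbol), $w=h$ at $t=0$. Put $I_t=\{x: w(x,t)>0\}$, $\Gamma_t=\{x: w(x,t)=0\}$, $O_t=\{x: w(x,t)<0\}$,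 and $t^*=\inf\{t>0:\Gamma_t=\emptyset\}$. For $0\le t\le t^*$, $d(x,t)=\mathrm{dist}(x,\Gamma_t)$ if $x\in I_t$, $0$ if $x\in\Gamma_t$, $-\mathrm{dist}(x,\Gamma_t)$ if $x\in O_t$. Auxiliary function (depending on $\delta$): $\eta(z)=-\frac58\delta$ for $z\le\frac\delta4$; $\eta(z)=-\frac{32}{\delta^3}z^4+\frac{48}{\delta^2}z^3-\frac{24}{\delta}z^2+5z-\delta$ for $\frac\delta4\le z\le\frac\delta2$; $\eta(z)=z-\delta$ for $z\ge\frac\delta2$. Global control map $v^\varepsilon:\mathbb{R}\to S^2$: for a given constant $k$, with $\mu=\sqrt{\alpha+\beta}/\varepsilon$ and $D=(\exp(2\mu r)+\frac\beta2)^2+2\alpha\exp(2\mu r)$, $$v_1^\varepsilon=\frac{\exp(2\mu r)-\frac\beta2}{\sqrt D}\cos k,\quad v_2^\varepsilon=\frac{\exp(2\mu r)-\frac\beta2}{\sqrt D}\sin k,\quad v_3^\varepsilon=\frac{\sqrt{2(\alpha+\beta)}\exp(\mu r)}{\sqrt D}.$$ Viscosity supersolution. For $u=v(r(x,t))$ with $v\in C^2(\mathbb{R};\mathbb{R}^3)$ taking values in $S^2$, the Landau-Lifshitz equation is rewritten as (E1) $(v_2v_1'-v_1v_2')(r_t-\Delta r)-(v_2v_1''-v_1v_2'')|\nabla r|^2=0$, (E2) $v_3'(r_t-\Delta r)-(v_3''+|v'|^2v_3)|\nabla r|^2+\frac1{\varepsilon^2}v_3(1-v_3^2)(\alpha+\beta-2\alpha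 v_3^2)=0$. $u$ is a viscosity supersolution if $u=v(r)$ with such a $v$ and with $r$ bounded lower semicontinuous, and it is a viscosity supersolution of both (E1) and (E2). Explicitly: whenever $\phi\in C^2(\mathbb{R}^n\times[0,\infty))$ and $r-\phi$ has a local minimum equal to $0$ at $(x_0,t_0)\in\mathbb{R}^n\times(0,t^* )$, then at $(x_0,t_0)$: (A) if $v_2(\phi)v_1'(\phi)-v_1(\phi)v_2'(\phi)=0$ then $v_2(\phi)v_1''(\phi)-v_1(\phi)v_2''(\phi)=0$; otherwise $\phi_t-\Delta\phi\ge\frac{v_2(\phi)v_1''(\phi)-v_1(\phi)v_2''(\phi)}{v_2(\phi)v_1'(\phi)-v_1(\phi)v_2'(\phi)}|\nabla\phi|^2$; (B) if $v_3'(\phi)=0$ then $(v_3''(\phi)+|v'(\phi)|^2v_3(\phi))|\nabla\phi|^2-\frac1{\varepsilon^2}v_3(\phi)(1-v_3^2(\phi))(\alpha+\beta-2\alpha v_3^2(\phi))=0$; otherwise $\phi_t-\Delta\phi\ge\frac{v_3''(\phi)+|v'(\phi)|^2v_3(\phi)}{v_3'(\phi)}|\nabla\phi|^2-\frac{\alpha+\beta-2\alpha v_3^2(\phi)}{\varepsilon^2}\frac{v_3(\phi)(1-v_3^2(\phi))}{v_3'(\phi)}$. *)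

theory Defs
  imports "HOL-Analysis.Analysis"
begin

section \<open>Differentiability classes and partial derivatives\<close>

text \<open>The class $C^k(S)$. It is only used for sets on which derivatives are unique: open sets, and the
  closed half space \<open>UNIV \<times> {0..}\<close>, where derivatives at boundary points are taken within the set.\<close>

fun C_k_on :: "nat \<Rightarrow> 'a set \<Rightarrow> ('a::real_normed_vector \<Rightarrow> 'b::real_normed_vector) \<Rightarrow> bool" where
  "C_k_on 0 S f \<longleftrightarrow> continuous_on S f"
| "C_k_on (Suc k) S f \<longleftrightarrow> f differentiable_on S \<and>
     (\<forall>v. C_k_on k S (\<lambda>x. frechet_derivative f (at x within S) v))"

definition C_inf_on :: "'a set \<Rightarrow> ('a::real_normed_vector \<Rightarrow> 'b::real_normed_vector) \<Rightarrow> bool" where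
  "C_inf_on S f \<longleftrightarrow> (\<forall>k. C_k_on k S f)"

definition partial_deriv :: "'n \<Rightarrow> (real^'n \<Rightarrow> real) \<Rightarrow> real^'n \<Rightarrow> real" where
  "partial_deriv i f x = frechet_derivative f (at x) (axis i 1)"

definition gradient :: "(real^'n \<Rightarrow> real) \<Rightarrow> real^'n \<Rightarrow> real^'n" where
  "gradient f x = (\<chi> i. partial_deriv i f x)"

definition hessian :: "(real^'n \<Rightarrow> real) \<Rightarrow> real^'n \<Rightarrow> real^'n^'n" where
  "hessian f x = (\<chi> i j. partial_deriv j (partial_deriv i f) x)"

definition laplacian :: "(real^'n \<Rightarrow> real) \<Rightarrow> real^'n \<Rightarrow> real" where
  "laplacian f x = (\<Sum>i\<in>UNIV. partial_deriv i (partial_deriv i f) x)"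

text \<open>For functions of \<open>(x, t)\<close> the subscript \<open>x\<close> refers to the space variable only.\<close>

definition grad_x :: "((real^'n) \<times> real \<Rightarrow> real) \<Rightarrow> (real^'n) \<times> real \<Rightarrow> real^'n" where
  "grad_x \<phi> p = gradient (\<lambda>x. \<phi> (x, snd p)) (fst p)"

definition hess_x :: "((real^'n) \<times> real \<Rightarrow> real) \<Rightarrow> (real^'n) \<times> real \<Rightarrow> real^'n^'n" where
  "hess_x \<phi> p = hessian (\<lambda>x. \<phi> (x, snd p)) (fst p)"

definition lap_x :: "((real^'n) \<times> real \<Rightarrow> real) \<Rightarrow> (real^'n) \<times> real \<Rightarrow> real" where
  "lap_x \<phi> p = laplacian (\<lambda>x. \<phi> (x, snd p)) (fst p)"

definition deriv_t :: "((real^'n) \<times> real \<Rightarrow> real) \<Rightarrow> (real^'n) \<times> real \<Rightarrow> real" where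
  "deriv_t \<phi> p = deriv (\<lambda>t. \<phi> (fst p, t)) (snd p)"

definition local_max_at :: "('a::topological_space \<Rightarrow> real) \<Rightarrow> 'a \<Rightarrow> bool" where
  "local_max_at f p \<longleftrightarrow> (\<forall>\<^sub>F q in nhds p. f q \<le> f p)"

definition local_min_at :: "('a::topological_space \<Rightarrow> real) \<Rightarrow> 'a \<Rightarrow> bool" where
  "local_min_at f p \<longleftrightarrow> (\<forall>\<^sub>F q in nhds p. f p \<le> f q)"

definition lower_semicontinuous_on :: "'a::topological_space set \<Rightarrow> ('a \<Rightarrow> real) \<Rightarrow> bool" where
  "lower_semicontinuous_on S f \<longleftrightarrow> (\<forall>p\<in>S. \<forall>a<f p. \<forall>\<^sub>F q in at p within S. a < f q)"


section \<open>The domain and the initial function\<close>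

text \<open>Near each boundary point the domain lies strictly on one side of the graph of a $C^k$ function
  over the hyperplane orthogonal to a unit vector \<open>e\<close>. A function on that hyperplane is represented by
  a function \<open>g\<close> on the whole space evaluated at the orthogonal projection of \<open>x\<close>.\<close>

definition C_k_boundary :: "nat \<Rightarrow> (real^'n) set \<Rightarrow> bool" where
  "C_k_boundary k \<Omega> \<longleftrightarrow> (\<forall>x0\<in>frontier \<Omega>. \<exists>\<rho>>0. \<exists>e g. norm e = 1 \<and> C_k_on k UNIV g \<and>
     \<Omega> \<inter> ball x0 \<rho> = {x \<in> ball x0 \<rho>. x \<bullet> e > g (x - (x \<bullet> e) *\<^sub>R e)})"

definition bounded_C3_domain :: "(real^'n) set \<Rightarrow> bool" where
  "bounded_C3_domain \<Omega> \<longleftrightarrow>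
     open \<Omega> \<and> connected \<Omega> \<and> \<Omega> \<noteq> {} \<and> bounded \<Omega> \<and> C_k_boundary 3 \<Omega>"

text \<open>The function \<open>h\<close> is the signed distance near the boundary, so it can only be as regular as the
  boundary: ``smooth'' is read as $C^3$, which covers the $C^\infty$ case.\<close>

definition initial_function :: "(real^'n) set \<Rightarrow> (real^'n \<Rightarrow> real) \<Rightarrow> bool" where
  "initial_function \<Omega> h \<longleftrightarrow>
     continuous_on UNIV h \<and>
     (\<exists>U. open U \<and> frontier \<Omega> \<subseteq> U \<and> C_k_on 3 U h \<and> (\<forall>x\<in>U. norm (gradient h x) = 1)) \<and>
     (\<exists>R c. \<forall>x. norm x \<ge> R \<longrightarrow> h x = c) \<and>
     (\<forall>x\<in>\<Omega>. h x > 0) \<and> (\<forall>x\<in>frontier \<Omega>. h x = 0) \<and> (\<forall>x. x \<notin> closure \<Omega> \<longrightarrow> h x < 0)"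


section \<open>Generalized mean curvature evolution\<close>

definition curvature_op :: "real^'n \<Rightarrow> real^'n^'n \<Rightarrow> real" where
  "curvature_op \<xi> X = (\<Sum>i\<in>UNIV. \<Sum>j\<in>UNIV. ((if i = j then 1 else 0) - \<xi>$i * \<xi>$j) * X$i$j)"

text \<open>Weak sub- and supersolutions in the sense of Evans and Spruck, tested with
  $C^\infty$ functions on space-time. Where the spatial gradient of the test function vanishes, the
  unit normal is replaced by some vector of length at most one.\<close>

definition mcf_weak_subsolution :: "((real^'n) \<times> real \<Rightarrow> real) \<Rightarrow> bool" where
  "mcf_weak_subsolution w \<longleftrightarrow>
     (\<forall>\<phi> x0 t0. C_inf_on UNIV \<phi> \<and> t0 > 0 \<and> local_max_at (\<lambda>p. w p - \<phi> p) (x0, t0) \<longrightarrow>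
       (if grad_x \<phi> (x0, t0) \<noteq> 0
        then deriv_t \<phi> (x0, t0) \<le> curvature_op (grad_x \<phi> (x0, t0) /\<^sub>R norm (grad_x \<phi> (x0, t0))) (hess_x \<phi> (x0, t0))
        else \<exists>\<xi>. norm \<xi> \<le> 1 \<and> deriv_t \<phi> (x0, t0) \<le> curvature_op \<xi> (hess_x \<phi> (x0, t0))))"

definition mcf_weak_supersolution :: "((real^'n) \<times> real \<Rightarrow> real) \<Rightarrow> bool" where
  "mcf_weak_supersolution w \<longleftrightarrow>
     (\<forall>\<phi> x0 t0. C_inf_on UNIV \<phi> \<and> t0 > 0 \<and> local_min_at (\<lambda>p. w p - \<phi> p) (x0, t0) \<longrightarrow>
       (if grad_x \<phi> (x0, t0) \<noteq> 0
        then deriv_t \<phi> (x0, t0) \<ge> curvature_op (grad_x \<phi> (x0, t0) /\<^sub>R norm (grad_x \<phi> (x0, t0))) (hess_x \<phi> (x0, t0))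
        else \<exists>\<xi>. norm \<xi> \<le> 1 \<and> deriv_t \<phi> (x0, t0) \<ge> curvature_op \<xi> (hess_x \<phi> (x0, t0))))"

text \<open>The last conjunct describes the class in which Evans and Spruck prove existence and uniqueness
  for initial data that are constant outside a ball: the solution is constant on
  \<open>{(x, t). norm x + t \<ge> R}\<close> for some \<open>R\<close>. In particular it is bounded. In dimension one the
  curvature flow does not move and no such solution exists for the initial data above.\<close>

definition mcf_weak_solution :: "(real^'n \<Rightarrow> real) \<Rightarrow> ((real^'n) \<times> real \<Rightarrow> real) \<Rightarrow> bool" where
  "mcf_weak_solution h w \<longleftrightarrow>
     continuous_on (UNIV \<times> {0..}) w \<and>
     mcf_weak_subsolution w \<and> mcf_weak_supersolution w \<and>
     (\<forall>x. w (x, 0) = h x) \<and>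
     (\<exists>R c. \<forall>x t. t \<ge> 0 \<and> norm x + t \<ge> R \<longrightarrow> w (x, t) = c)"

definition front :: "((real^'n) \<times> real \<Rightarrow> real) \<Rightarrow> real \<Rightarrow> (real^'n) set" where
  "front w t = {x. w (x, t) = 0}"

definition extinction_time :: "((real^'n) \<times> real \<Rightarrow> real) \<Rightarrow> real" where
  "extinction_time w = Inf {t. t > 0 \<and> front w t = {}}"

definition signed_dist :: "((real^'n) \<times> real \<Rightarrow> real) \<Rightarrow> (real^'n) \<times> real \<Rightarrow> real" where
  "signed_dist w p =
     (if w p > 0 then infdist (fst p) (front w (snd p))
      else if w p = 0 then 0
      else - infdist (fst p) (front w (snd p)))"


section \<open>The Landau-Lifshitz equation\<close>

definition H_field :: "real \<Rightarrow> real \<Rightarrow> real^3 \<Rightarrow> real^3" where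
  "H_field \<alpha> \<beta> u = vector [\<alpha> * u$1 * (u$3)\<^sup>2, \<alpha> * u$2 * (u$3)\<^sup>2,
                           \<alpha> * (u$1)\<^sup>2 * u$3 + \<alpha> * (u$2)\<^sup>2 * u$3 + \<beta> * u$3]"

text \<open>For \<open>u = v (r (x, t))\<close> with \<open>v\<close> on the unit sphere write \<open>a\<close>, \<open>b\<close>, \<open>q\<close> for $r_t$, $\Delta r$,
  $|\nabla r|^2$ and \<open>v\<close>, \<open>v1\<close>, \<open>v2\<close> for \<open>v\<close> and its first two derivatives at \<open>r\<close>. Then
  $u_t = a v_1$ and $\Delta u = b v_1 + q v_2$, and the lemma computes two combinations of the
  components of $u_t + u \times (u \times (\Delta u - H(u)/\varepsilon^2))$. Setting them to zero gives the
  two scalar equations whose viscosity supersolutions are defined below.\<close>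

lemma landau_lifshitz_residual:
  fixes v v1 v2 :: "real^3" and a b q \<alpha> \<beta> \<epsilon> :: real
  assumes 0: "v \<bullet> v = 1" "v \<bullet> v1 = 0" "v \<bullet> v2 + v1 \<bullet> v1 = 0"
  defines "X \<equiv> b *\<^sub>R v1 + q *\<^sub>R v2 - (1 / \<epsilon>\<^sup>2) *\<^sub>R H_field \<alpha> \<beta> v"
  defines "R \<equiv> a *\<^sub>R v1 + cross3 v (cross3 v X)"
  shows "v$2 * R$1 - v$1 * R$2 = (v$2 * v1$1 - v$1 * v1$2) * (a - b) - (v$2 * v2$1 - v$1 * v2$2) * q"
    and "R$3 = v1$3 * (a - b) - (v2$3 + (norm v1)\<^sup>2 * v$3) * q
           + 1 / \<epsilon>\<^sup>2 * v$3 * (1 - (v$3)\<^sup>2) * (\<alpha> + \<beta> - 2 * \<alpha> * (v$3)\<^sup>2)"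
proof -
  define c where "c = 1 / \<epsilon>\<^sup>2"
  have R: "R = a *\<^sub>R v1 + (v \<bullet> X) *\<^sub>R v - X"
    using 0(1) by (simp add: R_def Lagrange)
  have v3: "(v$1)\<^sup>2 + (v$2)\<^sup>2 = 1 - (v$3)\<^sup>2"
    using 0(1) by (simp add: inner_vec_def sum_3 power2_eq_square)
  have H: "H_field \<alpha> \<beta> v $ 1 = \<alpha> * v$1 * (v$3)\<^sup>2" "H_field \<alpha> \<beta> v $ 2 = \<alpha> * v$2 * (v$3)\<^sup>2"
    "H_field \<alpha> \<beta> v $ 3 = \<alpha> * (1 - (v$3)\<^sup>2) * v$3 + \<beta> * v$3"
    unfolding v3[symmetric] by (simp_all add: H_field_def algebra_simps)
  have "v \<bullet> H_field \<alpha> \<beta> v = \<alpha> * (v$3)\<^sup>2 * ((v$1)\<^sup>2 + (v$2)\<^sup>2) + v$3 * H_field \<alpha> \<beta> v $ 3"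
    by (simp add: inner_vec_def sum_3 H(1,2) power2_eq_square algebra_simps)
  then have vH: "v \<bullet> H_field \<alpha> \<beta> v = 2 * \<alpha> * (v$3)\<^sup>2 * (1 - (v$3)\<^sup>2) + \<beta> * (v$3)\<^sup>2"
    unfolding v3 H by (simp add: power2_eq_square algebra_simps)
  have vX: "v \<bullet> X = - q * (norm v1)\<^sup>2 - c * (v \<bullet> H_field \<alpha> \<beta> v)"
    using 0(2,3) by (simp add: X_def c_def inner_diff_right inner_add_right power2_norm_eq_inner
        eq_neg_iff_add_eq_0[symmetric])
  show "v$2 * R$1 - v$1 * R$2 = (v$2 * v1$1 - v$1 * v1$2) * (a - b) - (v$2 * v2$1 - v$1 * v2$2) * q"
    unfolding R by (simp add: X_def H algebra_simps)
  show "R$3 = v1$3 * (a - b) - (v2$3 + (norm v1)\<^sup>2 * v$3) * q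
           + 1 / \<epsilon>\<^sup>2 * v$3 * (1 - (v$3)\<^sup>2) * (\<alpha> + \<beta> - 2 * \<alpha> * (v$3)\<^sup>2)"
  proof -
    have R3: "R$3 = a * v1$3 + (v \<bullet> X) * v$3 - X$3" by (simp add: R)
    have X3: "X$3 = b * v1$3 + q * v2$3 - c * (\<alpha> * (1 - (v$3)\<^sup>2) * v$3 + \<beta> * v$3)"
      by (simp add: X_def H(3) c_def)
    show ?thesis
      unfolding R3 vX vH X3 c_def[symmetric] by (simp only: power2_eq_square) algebra
  qed
qed

text \<open>Only test functions touching \<open>r\<close> from below with contact value zero are admitted, so
  the coefficients of the two scalar equations may be evaluated at \<open>\<phi> p = r p\<close>.\<close>

definition touches_below :: "(real^'n) \<times> real \<Rightarrow> ((real^'n) \<times> real \<Rightarrow> real) \<Rightarrow> ((real^'n) \<times> real \<Rightarrow> real) \<Rightarrow> bool" where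
  "touches_below p \<phi> r \<longleftrightarrow>
     C_k_on 2 (UNIV \<times> {0..}) \<phi> \<and> local_min_at (\<lambda>q. r q - \<phi> q) p \<and> r p - \<phi> p = 0"

definition d1 :: "(real \<Rightarrow> real^3) \<Rightarrow> real \<Rightarrow> real^3" where
  "d1 v s = vector_derivative v (at s)"

definition d2 :: "(real \<Rightarrow> real^3) \<Rightarrow> real \<Rightarrow> real^3" where
  "d2 v s = vector_derivative (d1 v) (at s)"

definition E1_supersolution ::
    "real \<Rightarrow> (real \<Rightarrow> real^3) \<Rightarrow> ((real^'n) \<times> real \<Rightarrow> real) \<Rightarrow> bool" where
  "E1_supersolution T v r \<longleftrightarrow>
     (\<forall>\<phi> p. snd p \<in> {0<..<T} \<and> touches_below p \<phi> r \<longrightarrow>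
       (let y = v (\<phi> p); y1 = d1 v (\<phi> p); y2 = d2 v (\<phi> p) in
        if y$2 * y1$1 - y$1 * y1$2 = 0 then y$2 * y2$1 - y$1 * y2$2 = 0
        else deriv_t \<phi> p - lap_x \<phi> p
               \<ge> (y$2 * y2$1 - y$1 * y2$2) / (y$2 * y1$1 - y$1 * y1$2) * (norm (grad_x \<phi> p))\<^sup>2))"

definition E2_supersolution ::
    "real \<Rightarrow> real \<Rightarrow> real \<Rightarrow> real \<Rightarrow> (real \<Rightarrow> real^3) \<Rightarrow> ((real^'n) \<times> real \<Rightarrow> real) \<Rightarrow> bool" where
  "E2_supersolution \<alpha> \<beta> \<epsilon> T v r \<longleftrightarrow>
     (\<forall>\<phi> p. snd p \<in> {0<..<T} \<and> touches_below p \<phi> r \<longrightarrow>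
       (let y = v (\<phi> p); y1 = d1 v (\<phi> p); y2 = d2 v (\<phi> p) in
        if y1$3 = 0
        then (y2$3 + (norm y1)\<^sup>2 * y$3) * (norm (grad_x \<phi> p))\<^sup>2
               - 1 / \<epsilon>\<^sup>2 * y$3 * (1 - (y$3)\<^sup>2) * (\<alpha> + \<beta> - 2 * \<alpha> * (y$3)\<^sup>2) = 0
        else deriv_t \<phi> p - lap_x \<phi> p
               \<ge> (y2$3 + (norm y1)\<^sup>2 * y$3) / y1$3 * (norm (grad_x \<phi> p))\<^sup>2
                 - (\<alpha> + \<beta> - 2 * \<alpha> * (y$3)\<^sup>2) / \<epsilon>\<^sup>2 * (y$3 * (1 - (y$3)\<^sup>2) / y1$3)))"

text \<open>The notion depends on the way \<open>u\<close> is written as \<open>v \<circ> r\<close>, so the pair \<open>(v, r)\<close> is an explicit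
  argument instead of being existentially quantified.\<close>

definition LL_viscosity_supersolution ::
    "real \<Rightarrow> real \<Rightarrow> real \<Rightarrow> real \<Rightarrow> (real \<Rightarrow> real^3) \<Rightarrow> ((real^'n) \<times> real \<Rightarrow> real)
      \<Rightarrow> ((real^'n) \<times> real \<Rightarrow> real^3) \<Rightarrow> bool" where
  "LL_viscosity_supersolution \<alpha> \<beta> \<epsilon> T v r u \<longleftrightarrow>
     (\<forall>p\<in>UNIV \<times> {0<..<T}. u p = v (r p)) \<and>
     C_k_on 2 UNIV v \<and> (\<forall>s. v s \<in> sphere 0 1) \<and>
     bounded (r ` (UNIV \<times> {0<..<T})) \<and> lower_semicontinuous_on (UNIV \<times> {0<..<T}) r \<and>
     E1_supersolution T v r \<and> E2_supersolution \<alpha> \<beta> \<epsilon> T v r"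


section \<open>The supersolution\<close>

definition eta :: "real \<Rightarrow> real \<Rightarrow> real" where
  "eta \<delta> z =
     (if z \<le> \<delta> / 4 then - 5 / 8 * \<delta>
      else if z \<le> \<delta> / 2
      then - 32 / \<delta>^3 * z^4 + 48 / \<delta>^2 * z^3 - 24 / \<delta> * z^2 + 5 * z - \<delta>
      else z - \<delta>)"

definition control_map :: "real \<Rightarrow> real \<Rightarrow> real \<Rightarrow> real \<Rightarrow> real \<Rightarrow> real^3" where
  "control_map \<alpha> \<beta> k \<epsilon> r =
     (let \<mu> = sqrt (\<alpha> + \<beta>) / \<epsilon>;
          D = (exp (2 * \<mu> * r) + \<beta> / 2)\<^sup>2 + 2 * \<alpha> * exp (2 * \<mu> * r)
      in vector [(exp (2 * \<mu> * r) - \<beta> / 2) / sqrt D * cos k,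
                 (exp (2 * \<mu> * r) - \<beta> / 2) / sqrt D * sin k,
                 sqrt (2 * (\<alpha> + \<beta>)) * exp (\<mu> * r) / sqrt D])"

end

theory Submission
  imports Defs
begin

text \<open>
The control map runs along a meridian of the sphere, so the first scalar equation holds
identically. Its third component is a one-dimensional stationary solution: the source term of the
second equation equals the coefficient of $|\nabla r|^2$. The second equation therefore
reduces to $\phi_t - \Delta\phi \ge \mu X (|\nabla\phi|^2 - 1)$, where \<open>X\<close> is explicit in \<open>\<phi>\<close> and tends
to one as $\mu\phi \to -\infty$ (\<open>control_map_stationary\<close>, \<open>control_coefficient\<close>).

Let \<open>\<rho>(x, t)\<close> be the distance from \<open>x\<close> to the set where \<open>w(\<cdot>, t) \<le> 0\<close>. It is the positive part of
the signed distance, and \<open>\<eta>\<close> does not see the rest. So the profile is \<open>\<eta>(\<rho>) + c t\<close> with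
\<open>c = \<delta> / (4 t*)\<close>. If \<open>\<phi>\<close> touches it from below at a point with \<open>\<rho> = d\<close>, then
$|\nabla\phi| = \eta'(d)$ and $\phi_t - \Delta\phi \ge c - \eta''(d)$ (\<open>profile_jet\<close>), for two
different reasons.

For \<open>d > \<delta>/4\<close>, translate \<open>\<phi>\<close> so that the contact point moves to a nearest point of the
nonpositive set of \<open>w\<close>. After subtraction of \<open>\<eta>(d) + c t\<close> the translate is
nonpositive on that set near the nearest point. Testing the supersolution \<open>w\<close> with $-e^{-K\psi}/K$ for a quadratic polynomial
\<open>\<psi>\<close> and large \<open>K\<close> shows that such a touching function obeys the mean curvature inequality
(\<open>nonpositive_set_touched_by_quad\<close>). The second derivative of \<open>\<phi>\<close> in the normal direction, which
mean curvature leaves out, is at most $\eta''(d)$.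

For \<open>d \<le> \<delta>/4\<close>, the gradient vanishes and the spatial Hessian is nonpositive on the diagonal, but
\<open>\<phi>\<close> could still have a very negative time derivative if \<open>\<rho>\<close> dropped abruptly. It cannot: a ball in
the positive set survives while its radius shrinks at a bounded rate
(\<open>positive_ball_persists\<close>).

It remains to compare $c - \eta''$ with $\mu X ((\eta')^2 - 1)$. For \<open>d > \<delta>/2\<close> the latter vanishes
and so does \<open>\<eta>''\<close>. For \<open>d \<le> \<delta>/2\<close> the profile is at most \<open>-\<delta>/4\<close>, so \<open>X \<ge> 1/2\<close> once \<open>\<mu>\<close> is large,
and $\mu (1 - (\eta')^2) / 2$ dominates $\eta'' - c$: near \<open>\<delta>/2\<close> the former is quadratic and
\<open>\<eta>''\<close> linear in the distance to \<open>\<delta>/2\<close>, and the constant \<open>c\<close> makes up the difference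
(\<open>eta_curvature_absorbed\<close>).
\<close>

section \<open>Closure properties of smooth functions\<close>

lemma C_k_on_SucD: "C_k_on (Suc k) S f \<Longrightarrow> C_k_on k S f"
proof (induction k arbitrary: f)
  case 0
  then show ?case by (simp add: differentiable_imp_continuous_on)
next
  case (Suc k)
  then show ?case by (metis C_k_on.simps(2))
qed

lemma C_k_on_UNIV_Suc_iff:
  assumes "\<And>x. (f has_derivative f' x) (at x)"
  shows "C_k_on (Suc k) UNIV f \<longleftrightarrow> (\<forall>v. C_k_on k UNIV (\<lambda>x. f' x v))"
proof -
  have "frechet_derivative f (at x) = f' x" for x
    using frechet_derivative_at[OF assms] by simp
  moreover have "f differentiable_on UNIV"
    using assms by (auto simp: differentiable_on_def differentiable_def)
  ultimately show ?thesis by simp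
qed

lemma C_k_on_UNIV_has_derivative:
  assumes "C_k_on (Suc k) UNIV f"
  shows "(f has_derivative frechet_derivative f (at x)) (at x)"
  using assms by (auto simp: differentiable_on_def frechet_derivative_works)

lemma C_k_on_UNIV_const: "C_k_on k UNIV (\<lambda>x. c)"
proof (induction k arbitrary: c)
  case (Suc k)
  then show ?case by (subst C_k_on_UNIV_Suc_iff[where f' = "\<lambda>x v. 0"]) auto
qed auto

lemma C_k_on_UNIV_bounded_linear:
  assumes "bounded_linear f"
  shows "C_k_on k UNIV f"
proof (cases k)
  case 0
  then show ?thesis by (simp add: linear_continuous_on assms)
next
  case (Suc n)
  then show ?thesis
    by (simp add: C_k_on_UNIV_Suc_iff[OF bounded_linear_imp_has_derivative[OF assms]]
        C_k_on_UNIV_const del: C_k_on.simps)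
qed

lemma C_k_on_UNIV_add:
  "C_k_on k UNIV f \<Longrightarrow> C_k_on k UNIV g \<Longrightarrow> C_k_on k UNIV (\<lambda>x. f x + g x)"
proof (induction k arbitrary: f g)
  case (Suc k)
  show ?case
    using Suc.prems
    by (subst C_k_on_UNIV_Suc_iff[OF has_derivative_add[OF
          C_k_on_UNIV_has_derivative[OF Suc.prems(1)] C_k_on_UNIV_has_derivative[OF Suc.prems(2)]]])
      (auto intro!: Suc.IH)
qed (simp add: continuous_on_add)

lemma C_k_on_UNIV_mult:
  fixes f g :: "'a::real_normed_vector \<Rightarrow> real"
  shows "C_k_on k UNIV f \<Longrightarrow> C_k_on k UNIV g \<Longrightarrow> C_k_on k UNIV (\<lambda>x. f x * g x)"
proof (induction k arbitrary: f g)
  case (Suc k)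
  show ?case
    using Suc.prems C_k_on_SucD[OF Suc.prems(1)] C_k_on_SucD[OF Suc.prems(2)]
    by (subst C_k_on_UNIV_Suc_iff[OF has_derivative_mult[OF
          C_k_on_UNIV_has_derivative[OF Suc.prems(1)] C_k_on_UNIV_has_derivative[OF Suc.prems(2)]]])
      (auto intro!: Suc.IH C_k_on_UNIV_add)
qed (simp add: continuous_on_mult)

lemma C_k_on_UNIV_exp:
  fixes f :: "'a::real_normed_vector \<Rightarrow> real"
  shows "C_k_on k UNIV f \<Longrightarrow> C_k_on k UNIV (\<lambda>x. exp (f x))"
proof (induction k arbitrary: f)
  case (Suc k)
  show ?case
    using Suc.prems C_k_on_SucD[OF Suc.prems]
    by (subst C_k_on_UNIV_Suc_iff[OF has_derivative_exp[OF C_k_on_UNIV_has_derivative[OF Suc.prems]]])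
      (auto intro!: Suc.IH C_k_on_UNIV_mult)
qed (simp add: continuous_on_exp)

lemma C_k_on_UNIV_sum:
  assumes "\<And>i. i \<in> I \<Longrightarrow> C_k_on k UNIV (f i)"
  shows "C_k_on k UNIV (\<lambda>x. \<Sum>i\<in>I. f i x)"
  using assms
  by (induction I rule: infinite_finite_induct) (auto intro: C_k_on_UNIV_const C_k_on_UNIV_add)

section \<open>Second order lower jets\<close>

text \<open>The quadratic polynomials with spatial gradient \<open>b\<close>, Hessian \<open>B\<close> (if \<open>B\<close> is symmetric) and time derivative \<open>c\<close> at the
  origin. The only second order term in time is a negative multiple of the square, and there is no
  mixed term: lower bounds absorb a mixed term into the two pure squares.\<close>
definition quad :: "real^'n \<Rightarrow> real^'n^'n \<Rightarrow> real \<Rightarrow> real \<Rightarrow> (real^'n) \<times> real \<Rightarrow> real" where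
  "quad b B c M q = b \<bullet> fst q + (fst q \<bullet> (B *v fst q)) / 2 + c * snd q - M * (snd q)\<^sup>2"

lemma partial_deriv_eq:
  "(f has_derivative f') (at x) \<Longrightarrow> partial_deriv i f x = f' (axis i 1)"
  by (simp add: partial_deriv_def frechet_derivative_at[symmetric])

text \<open>Differentiability of the gradient at the single point \<open>0\<close> suffices: along a ray, the mean value
  theorem applied to \<open>f\<close> minus its candidate polynomial leaves the linearization error of \<open>G\<close>.\<close>
lemma second_order_taylor_peano:
  fixes f :: "'a::real_inner \<Rightarrow> real"
  assumes f: "\<forall>\<^sub>F y in nhds 0. (f has_derivative (\<lambda>h. h \<bullet> G y)) (at y)"
    and G: "(G has_derivative L) (at 0)" and "\<epsilon> > 0"
  shows "\<forall>\<^sub>F y in nhds 0. \<bar>f y - (f 0 + y \<bullet> G 0 + (y \<bullet> L y) / 2)\<bar> \<le> \<epsilon> * (norm y)\<^sup>2"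
proof -
  interpret L: bounded_linear L
    by (rule has_derivative_bounded_linear[OF G])
  obtain d1 where d1: "d1 > 0" "\<And>y. norm y < d1 \<Longrightarrow> (f has_derivative (\<lambda>h. h \<bullet> G y)) (at y)"
    using f by (auto simp: eventually_nhds_metric)
  obtain d2 where d2: "d2 > 0" "\<And>y. norm y < d2 \<Longrightarrow> norm (G y - G 0 - L y) \<le> \<epsilon> * norm y"
    using G \<open>\<epsilon> > 0\<close> by (auto simp: has_derivative_at_alt)
  have "\<bar>f y - (f 0 + y \<bullet> G 0 + (y \<bullet> L y) / 2)\<bar> \<le> \<epsilon> * (norm y)\<^sup>2" if y: "norm y < min d1 d2" for y
  proof -
    define g where "g s = f (s *\<^sub>R y) - s * (y \<bullet> G 0) - s\<^sup>2 / 2 * (y \<bullet> L y)" for s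
    have small: "norm (s *\<^sub>R y) < min d1 d2" if "0 \<le> s" "s \<le> 1" for s
      using that y by (smt (verit, best) mult_left_le_one_le norm_ge_zero norm_scaleR abs_of_nonneg)
    have "(g has_real_derivative y \<bullet> (G (s *\<^sub>R y) - G 0 - L (s *\<^sub>R y))) (at s)" if "0 \<le> s" "s \<le> 1" for s
    proof -
      have "((\<lambda>s. f (s *\<^sub>R y)) has_derivative (\<lambda>h. (h *\<^sub>R y) \<bullet> G (s *\<^sub>R y))) (at s)"
        by (rule has_derivative_compose[where f = "\<lambda>s. s *\<^sub>R y"])
          (use d1(2)[of "s *\<^sub>R y"] small[OF that] in \<open>auto intro!: derivative_eq_intros\<close>)
      then have "((\<lambda>s. f (s *\<^sub>R y)) has_real_derivative y \<bullet> G (s *\<^sub>R y)) (at s)"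
        unfolding has_field_derivative_def by (rule has_derivative_eq_rhs) (simp add: fun_eq_iff)
      then show ?thesis
        unfolding g_def
        by - (rule derivative_eq_intros refl | assumption | simp add: inner_diff_right L.scaleR)+
    qed
    then obtain s where s: "0 < s" "s < 1" "g 1 - g 0 = (1 - 0) * (y \<bullet> (G (s *\<^sub>R y) - G 0 - L (s *\<^sub>R y)))"
      using MVT2[of 0 1 g "\<lambda>s. y \<bullet> (G (s *\<^sub>R y) - G 0 - L (s *\<^sub>R y))"] by auto
    have "\<bar>g 1 - g 0\<bar> \<le> norm y * norm (G (s *\<^sub>R y) - G 0 - L (s *\<^sub>R y))"
      using s(3) Cauchy_Schwarz_ineq2[of y "G (s *\<^sub>R y) - G 0 - L (s *\<^sub>R y)"] by simp
    also have "\<dots> \<le> norm y * (\<epsilon> * norm (s *\<^sub>R y))"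
      using d2(2)[of "s *\<^sub>R y"] small[of s] s by (intro mult_left_mono) auto
    also have "\<dots> \<le> norm y * (\<epsilon> * norm y)"
      using s \<open>\<epsilon> > 0\<close> by (intro mult_left_mono) (auto intro!: mult_left_le_one_le)
    finally show ?thesis
      by (simp add: g_def power2_eq_square algebra_simps)
  qed
  then show ?thesis
    unfolding eventually_nhds_metric using d1(1) d2(1) by (intro exI[of _ "min d1 d2"]) auto
qed

text \<open>A parabolic second order subjet: \<open>a\<close>, \<open>b\<close> and \<open>A\<close> stand for the time derivative, the spatial
  gradient and the spatial Hessian of a function touching \<open>r\<close> from below. All information about test
  functions that is used below passes through this one-sided expansion.\<close>
definition lower_jet ::
    "((real^'n) \<times> real \<Rightarrow> real) \<Rightarrow> (real^'n) \<times> real \<Rightarrow> real \<Rightarrow> real^'n \<Rightarrow> real^'n^'n \<Rightarrow> bool" where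
  "lower_jet r p a b A \<longleftrightarrow> (\<forall>\<epsilon>>0. \<exists>M. \<forall>\<^sub>F q in nhds 0.
     r p + quad b A a M q - \<epsilon> * (norm (fst q))\<^sup>2 \<le> r (p + q))"

text \<open>The expansion is split as space at fixed time plus an increment in time. The second part is
  linear in time with slope $\phi_t$ evaluated nearby. Since $\phi_t$ is differentiable, the error is at most
  \<open>L (|y| + |\<tau>|) |\<tau>|\<close>, which Young's inequality turns into \<open>\<epsilon> |y|\<^sup>2 / 2 + M \<tau>\<^sup>2\<close>.\<close>
lemma lower_jet_of_C2:
  fixes \<phi> :: "(real^'n) \<times> real \<Rightarrow> real"
  assumes C2: "C_k_on 2 (UNIV \<times> {0..}) \<phi>" and "snd p > 0"
  shows "lower_jet \<phi> p (deriv_t \<phi> p) (grad_x \<phi> p) (hess_x \<phi> p)"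
proof -
  obtain x0 t0 where p: "p = (x0, t0)" by (cases p)
  have "t0 > 0" using assms(2) by (simp add: p)
  define S where "S = (UNIV :: (real^'n) set) \<times> {0::real..}"
  define D where "D q v = frechet_derivative \<phi> (at q) v" for q v
  have open_pos: "open ((UNIV :: (real^'n) set) \<times> {0::real<..})"
    by (intro open_Times) auto
  have at_S: "at q within S = at q" if "snd q > 0" for q
    by (rule at_within_open_subset[OF _ open_pos]) (use that in \<open>auto simp: S_def mem_Times_iff\<close>)
  have C: "\<phi> differentiable_on S" "\<And>v. (\<lambda>q. frechet_derivative \<phi> (at q within S) v) differentiable_on S"
    using C2 by (auto simp: S_def numeral_2_eq_2)
  have D: "(\<phi> has_derivative D q) (at q)" if "snd q > 0" for q
  proof -
    have "\<phi> differentiable (at q within S)"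
      using C(1) that by (cases q) (auto simp: differentiable_on_def S_def)
    then show ?thesis
      unfolding D_def using at_S[OF that] by (simp add: frechet_derivative_works)
  qed
  have "\<exists>E. ((\<lambda>q. D q v) has_derivative E) (at p)" for v
  proof -
    have "(\<lambda>q. frechet_derivative \<phi> (at q within S) v) differentiable (at p)"
      using bspec[OF C(2)[of v, unfolded differentiable_on_def], of p] at_S[of p] \<open>t0 > 0\<close>
      by (auto simp: p S_def)
    then obtain E where "((\<lambda>q. frechet_derivative \<phi> (at q within S) v) has_derivative E) (at p)"
      by (auto simp: differentiable_def)
    then have "((\<lambda>q. D q v) has_derivative E) (at p)"
      by (rule has_derivative_transform_within_open[OF _ open_pos])
        (use \<open>t0 > 0\<close> at_S in \<open>auto simp: p D_def\<close>)
    then show ?thesis by blast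
  qed
  then obtain E where E: "\<And>v. ((\<lambda>q. D q v) has_derivative E v) (at p)"
    by metis
  have D_lin: "linear (D q)" if "snd q > 0" for q
    using D[OF that] has_derivative_linear by blast
  have dx: "((\<lambda>x. \<phi> (x, t)) has_derivative (\<lambda>h. D (x, t) (h, 0))) (at x)" if "t > 0" for x t
    by (rule has_derivative_compose[where f = "\<lambda>x. (x, t)"])
      (use D[of "(x, t)"] that in \<open>auto intro!: derivative_eq_intros\<close>)
  have dt: "((\<lambda>t. \<phi> (x, t)) has_real_derivative D (x, t) (0, 1)) (at t)" if "t > 0" for x t
  proof -
    have "((\<lambda>t. \<phi> (x, t)) has_derivative (\<lambda>h. D (x, t) (0, h))) (at t)"
      by (rule has_derivative_compose[where f = "\<lambda>t. (x, t)"])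
        (use D[of "(x, t)"] that in \<open>auto intro!: derivative_eq_intros\<close>)
    moreover have "(\<lambda>h. D (x, t) (0, h)) = (\<lambda>h. D (x, t) (0, 1) * h)"
    proof
      fix h :: real
      have "D (x, t) (h *\<^sub>R (0, 1)) = h *\<^sub>R D (x, t) (0, 1)"
        by (rule linear_scale[OF D_lin]) (use that in simp)
      then show "D (x, t) (0, h) = D (x, t) (0, 1) * h"
        by (simp only: scaleR_Pair scaleR_zero_right real_scaleR_def mult_1_right mult_1_left mult.commute)
    qed
    ultimately show ?thesis
      unfolding has_field_derivative_def by (rule has_derivative_eq_rhs)
  qed
  define G where "G y = (\<chi> i. D (x0 + y, t0) (axis i 1, 0))" for y
  have pd: "partial_deriv i (\<lambda>x. \<phi> (x, t0)) = (\<lambda>x. D (x, t0) (axis i 1, 0))" for i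
    using partial_deriv_eq[OF dx] \<open>t0 > 0\<close> by (auto simp: fun_eq_iff)
  have dD: "((\<lambda>x. D (x, t0) (axis i 1, 0)) has_derivative (\<lambda>h. E (axis i 1, 0) (h, 0))) (at x0)" for i
    by (rule has_derivative_compose[where f = "\<lambda>x. (x, t0)"])
      (use E[of "(axis i 1, 0)"] in \<open>auto intro!: derivative_eq_intros simp: p\<close>)
  have hess: "hess_x \<phi> p = (\<chi> i j. E (axis i 1, 0) (axis j 1, 0))"
    by (simp add: hess_x_def hessian_def p pd partial_deriv_eq[OF dD])
  have grad: "grad_x \<phi> p = G 0"
    by (simp add: grad_x_def gradient_def p pd G_def)
  have time: "deriv_t \<phi> p = D p (0, 1)"
    using dt[OF \<open>t0 > 0\<close>] by (simp add: deriv_t_def p DERIV_imp_deriv)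
  have sum_axis: "(h :: real^'n, 0 :: real) = (\<Sum>i\<in>UNIV. h $ i *\<^sub>R (axis i 1, 0))" for h
    by (simp add: prod_eq_iff fst_sum snd_sum basis_expansion[of h, unfolded scalar_mult_eq_scaleR])
  have D_G: "D (x0 + y, t0) (h, 0) = h \<bullet> G y" for h y
  proof -
    have "D (x0 + y, t0) (h, 0) = (\<Sum>i\<in>UNIV. h $ i *\<^sub>R D (x0 + y, t0) (axis i 1, 0))"
      unfolding sum_axis[of h] using D_lin[of "(x0 + y, t0)"] \<open>t0 > 0\<close>
      by (simp add: linear_sum linear_scale del: scaleR_Pair)
    then show ?thesis
      by (simp add: G_def inner_vec_def)
  qed
  have E_hess: "E (axis i 1, 0) (h, 0) = (hess_x \<phi> p *v h) $ i" for h i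
  proof -
    have "linear (E (axis i 1, 0))"
      using E has_derivative_linear by blast
    then have "E (axis i 1, 0) (h, 0) = (\<Sum>j\<in>UNIV. h $ j *\<^sub>R E (axis i 1, 0) (axis j 1, 0))"
      unfolding sum_axis[of h] by (simp add: linear_sum linear_scale del: scaleR_Pair)
    then show ?thesis
      by (simp add: hess matrix_vector_mult_def mult.commute)
  qed
  have dG: "(G has_derivative (\<lambda>h. hess_x \<phi> p *v h)) (at 0)"
  proof -
    have "((\<lambda>y. G y $ i) has_derivative (\<lambda>h. (hess_x \<phi> p *v h) $ i)) (at 0)" for i
      unfolding G_def vec_lambda_beta E_hess[symmetric]
      by (rule has_derivative_compose[where f = "\<lambda>y. x0 + y"])
        (use dD[of i] in \<open>auto intro!: derivative_eq_intros\<close>)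
    then show ?thesis
      by (subst has_derivative_componentwise_within)
        (auto simp: Basis_vec_def inner_axis)
  qed
  have space: "\<forall>\<^sub>F y in nhds 0. \<bar>\<phi> (x0 + y, t0) - (\<phi> (x0 + 0, t0) + y \<bullet> G 0 + (y \<bullet> (hess_x \<phi> p *v y)) / 2)\<bar>
      \<le> \<epsilon> * (norm y)\<^sup>2" if "\<epsilon> > 0" for \<epsilon>
  proof (rule second_order_taylor_peano[OF _ dG that], rule always_eventually, rule allI)
    fix y
    show "((\<lambda>y. \<phi> (x0 + y, t0)) has_derivative (\<lambda>h. h \<bullet> G y)) (at y)"
      unfolding D_G[symmetric]
      by (rule has_derivative_compose[where f = "\<lambda>y. x0 + y"])
        (use dx[of t0 "x0 + y"] \<open>t0 > 0\<close> in \<open>auto intro!: derivative_eq_intros\<close>)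
  qed
  obtain L d where L: "L > 0" "d > 0" "\<And>q. norm q < d \<Longrightarrow> \<bar>D (p + q) (0, 1) - D p (0, 1)\<bar> \<le> L * norm q"
  proof -
    obtain K where K: "K > 0" "\<And>q. norm (E (0, 1) q) \<le> norm q * K"
      using bounded_linear.pos_bounded[OF has_derivative_bounded_linear[OF E[of "(0, 1)"]]] by blast
    obtain d where d: "d > 0" "\<And>q. norm (q - p) < d \<Longrightarrow>
        norm (D q (0, 1) - D p (0, 1) - E (0, 1) (q - p)) \<le> 1 * norm (q - p)"
      using E[of "(0, 1)"] unfolding has_derivative_at_alt by (metis zero_less_one)
    have "\<bar>D (p + q) (0, 1) - D p (0, 1)\<bar> \<le> (1 + K) * norm q" if "norm q < d" for q
      using d(2)[of "p + q"] that K(2)[of q] by (simp add: algebra_simps abs_le_iff)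
    then show ?thesis
      using that[of "1 + K" d] K(1) d(1) by simp
  qed
  show ?thesis
    unfolding lower_jet_def
  proof (intro allI impI)
    fix \<epsilon> :: real assume "\<epsilon> > 0"
    define M where "M = L + L\<^sup>2 / (2 * \<epsilon>)"
    have "((\<lambda>q. fst q :: real^'n) \<longlongrightarrow> fst (0 :: (real^'n) \<times> real)) (nhds (0 :: (real^'n) \<times> real))"
      by (rule tendsto_fst[where f = "\<lambda>q. q", OF filterlim_ident])
    then have "\<forall>\<^sub>F q in nhds (0 :: (real^'n) \<times> real).
        \<bar>\<phi> (x0 + fst q, t0) - (\<phi> (x0 + 0, t0) + fst q \<bullet> G 0 + (fst q \<bullet> (hess_x \<phi> p *v fst q)) / 2)\<bar>
        \<le> \<epsilon> / 2 * (norm (fst q))\<^sup>2"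
      using space[of "\<epsilon> / 2"] \<open>\<epsilon> > 0\<close> by (auto simp: filterlim_iff)
    moreover have "\<forall>\<^sub>F q in nhds (0 :: (real^'n) \<times> real). norm q < min d t0"
      unfolding eventually_nhds_metric
      by (rule exI[of _ "min d t0"]) (use \<open>t0 > 0\<close> L(2) in auto)
    ultimately have "\<forall>\<^sub>F q in nhds 0.
        \<phi> p + quad (grad_x \<phi> p) (hess_x \<phi> p) (deriv_t \<phi> p) M q - \<epsilon> * (norm (fst q))\<^sup>2 \<le> \<phi> (p + q)"
    proof eventually_elim
      case (elim q)
      obtain y \<tau> where q: "q = (y, \<tau>)" by (cases q)
      have tau: "\<bar>\<tau>\<bar> \<le> norm q" "norm y \<le> norm q" "norm q \<le> norm y + \<bar>\<tau>\<bar>"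
        using norm_snd_le[where x = y and y = \<tau>] norm_fst_le[where x = y and y = \<tau>] norm_Pair_le[of y \<tau>] by (auto simp: q)
      have pos: "t0 + s * \<tau> > 0" if "0 \<le> s" "s \<le> 1" for s
      proof -
        have "\<bar>s * \<tau>\<bar> \<le> \<bar>\<tau>\<bar>"
          using that by (simp add: abs_mult mult_left_le_one_le)
        then show ?thesis using tau elim(2) by linarith
      qed
      have "((\<lambda>s. \<phi> (x0 + y, t0 + s * \<tau>)) has_real_derivative D (x0 + y, t0 + s * \<tau>) (0, 1) * \<tau>) (at s)"
        if "0 \<le> s" "s \<le> 1" for s
        by (rule DERIV_chain2[where f = "\<lambda>t. \<phi> (x0 + y, t)" and g = "\<lambda>s. t0 + s * \<tau>", OF dt[OF pos[OF that]]])
          (auto intro!: derivative_eq_intros)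
      then obtain s where s: "0 < s" "s < 1"
        "\<phi> (x0 + y, t0 + 1 * \<tau>) - \<phi> (x0 + y, t0 + 0 * \<tau>) = (1 - 0) * (D (x0 + y, t0 + s * \<tau>) (0, 1) * \<tau>)"
        using MVT2[of 0 1 "\<lambda>s. \<phi> (x0 + y, t0 + s * \<tau>)" "\<lambda>s. D (x0 + y, t0 + s * \<tau>) (0, 1) * \<tau>"] by auto
      define q' where "q' = (y, s * \<tau>)"
      have s\<tau>: "\<bar>s * \<tau>\<bar> \<le> \<bar>\<tau>\<bar>"
        using s by (simp add: abs_mult mult_left_le_one_le)
      then have "norm q' \<le> norm q"
        by (simp add: q'_def q norm_Pair abs_le_square_iff)
      then have "\<bar>D (p + q') (0, 1) - D p (0, 1)\<bar> \<le> L * norm q"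
        using L(3)[of q'] elim(2) L(1) by (smt (verit) mult_left_mono)
      also have "\<dots> \<le> L * (norm y + \<bar>\<tau>\<bar>)"
        using L(1) tau by simp
      finally have "\<bar>(D (p + q') (0, 1) - D p (0, 1)) * \<tau>\<bar> \<le> L * (norm y + \<bar>\<tau>\<bar>) * \<bar>\<tau>\<bar>"
        by (simp add: abs_mult mult_right_mono)
      also have "\<dots> \<le> \<epsilon> / 2 * (norm y)\<^sup>2 + M * \<tau>\<^sup>2"
      proof -
        have "0 \<le> (\<epsilon> * norm y - L * \<bar>\<tau>\<bar>)\<^sup>2 / (2 * \<epsilon>)"
          using \<open>\<epsilon> > 0\<close> by simp
        also have "\<dots> = \<epsilon> / 2 * (norm y)\<^sup>2 - L * norm y * \<bar>\<tau>\<bar> + L\<^sup>2 / (2 * \<epsilon>) * \<tau>\<^sup>2"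
          using \<open>\<epsilon> > 0\<close> by (simp add: power2_eq_square field_simps)
        finally show ?thesis
          by (simp add: M_def algebra_simps power2_eq_square)
      qed
      finally have "\<phi> (x0 + y, t0 + \<tau>) - \<phi> (x0 + y, t0) \<ge> D p (0, 1) * \<tau> - \<epsilon> / 2 * (norm y)\<^sup>2 - M * \<tau>\<^sup>2"
        using s(3) by (simp add: q'_def p algebra_simps)
      moreover have "\<phi> (x0 + y, t0) \<ge> \<phi> (x0, t0) + y \<bullet> G 0 + (y \<bullet> (hess_x \<phi> p *v y)) / 2 - \<epsilon> / 2 * (norm y)\<^sup>2"
        using elim(1) unfolding q fst_conv add_0_right by linarith
      ultimately have "\<phi> (x0 + y, t0 + \<tau>) \<ge> \<phi> (x0, t0) + y \<bullet> G 0 + (y \<bullet> (hess_x \<phi> p *v y)) / 2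
          + D p (0, 1) * \<tau> - M * \<tau>\<^sup>2 - \<epsilon> * (norm y)\<^sup>2"
        by linarith
      then show ?case
        unfolding quad_def grad time by (simp add: q p inner_commute[of y "G 0"])
    qed
    then show "\<exists>M. \<forall>\<^sub>F q in nhds 0.
        \<phi> p + quad (grad_x \<phi> p) (hess_x \<phi> p) (deriv_t \<phi> p) M q - \<epsilon> * (norm (fst q))\<^sup>2 \<le> \<phi> (p + q)" ..
  qed
qed

lemma lower_jet_touches_below:
  assumes "touches_below p \<phi> r" "snd p > 0"
  shows "lower_jet r p (deriv_t \<phi> p) (grad_x \<phi> p) (hess_x \<phi> p)"
  unfolding lower_jet_def
proof (intro allI impI)
  fix \<epsilon> :: real assume "\<epsilon> > 0"
  then obtain M where "\<forall>\<^sub>F q in nhds 0. \<phi> p + quad (grad_x \<phi> p) (hess_x \<phi> p) (deriv_t \<phi> p) M q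
      - \<epsilon> * (norm (fst q))\<^sup>2 \<le> \<phi> (p + q)"
    using lower_jet_of_C2[of \<phi> p] assms unfolding lower_jet_def touches_below_def by blast
  moreover have "\<forall>\<^sub>F q in nhds 0. r p - \<phi> p \<le> r (p + q) - \<phi> (p + q)"
  proof -
    have "((\<lambda>q. p + q) \<longlongrightarrow> p + 0) (nhds 0)"
      by (intro tendsto_intros filterlim_ident)
    then show ?thesis
      using assms by (auto simp: touches_below_def local_min_at_def filterlim_iff)
  qed
  ultimately have "\<forall>\<^sub>F q in nhds 0. r p + quad (grad_x \<phi> p) (hess_x \<phi> p) (deriv_t \<phi> p) M q
      - \<epsilon> * (norm (fst q))\<^sup>2 \<le> r (p + q)"
    by eventually_elim simp
  then show "\<exists>M. \<forall>\<^sub>F q in nhds 0. r p + quad (grad_x \<phi> p) (hess_x \<phi> p) (deriv_t \<phi> p) M q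
      - \<epsilon> * (norm (fst q))\<^sup>2 \<le> r (p + q)" ..
qed

section \<open>The set where a level set supersolution is nonpositive\<close>

lemma curvature_op_alt:
  "curvature_op \<xi> X = (\<Sum>i\<in>UNIV. X $ i $ i) - \<xi> \<bullet> (X *v \<xi>)"
proof -
  have "curvature_op \<xi> X = (\<Sum>i\<in>UNIV. (\<Sum>j\<in>UNIV. if i = j then X $ i $ j else 0)
      - (\<Sum>j\<in>UNIV. \<xi> $ i * (X $ i $ j * \<xi> $ j)))"
    unfolding curvature_op_def sum_subtractf[symmetric]
    by (intro sum.cong refl) (auto simp: algebra_simps)
  then show ?thesis
    by (simp add: sum_subtractf inner_vec_def matrix_vector_mult_def sum_distrib_left)
qed

text \<open>Composing a function with an increasing one changes its Hessian by a multiple of \<open>g g\<^sup>T\<close>, with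
  \<open>g\<close> the gradient. If \<open>\<xi> = g / |g|\<close> or \<open>g = 0\<close>, the additional term vanishes: the curvature operator
  is geometric.\<close>
lemma curvature_op_rank_one_update:
  "curvature_op \<xi> (\<chi> i j. e * (B $ i $ j - K * g $ i * g $ j))
    = e * (curvature_op \<xi> B - K * (g \<bullet> g - (g \<bullet> \<xi>)\<^sup>2))"
proof -
  have mv: "(\<chi> i j. e * (B $ i $ j - K * g $ i * g $ j)) *v \<xi> = e *\<^sub>R (B *v \<xi> - (K * (g \<bullet> \<xi>)) *\<^sub>R g)"
    by (simp add: vec_eq_iff matrix_vector_mult_def inner_vec_def sum_distrib_left sum_subtractf
        algebra_simps)
  show ?thesis
    unfolding curvature_op_alt mv
    by (simp add: sum_distrib_left[symmetric] sum_subtractf inner_diff_right mult.assoc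
        inner_vec_def[of g g] inner_commute[of g \<xi>] power2_eq_square algebra_simps)
qed

lemma scaled_identity_simps:
  "(c *\<^sub>R mat 1) *v x = c *\<^sub>R (x :: real^'n)"
  "transpose (c *\<^sub>R mat 1) = (c *\<^sub>R mat 1 :: real^'n^'n)"
  "curvature_op \<xi> (c *\<^sub>R mat 1 :: real^'n^'n) = c * (real CARD('n) - (norm \<xi>)\<^sup>2)"
  "curvature_op \<xi> (X + Y) = curvature_op \<xi> X + curvature_op \<xi> Y"
  "curvature_op \<xi> (c *\<^sub>R X) = c * curvature_op \<xi> X"
proof -
  show 1: "(c *\<^sub>R mat 1) *v x = c *\<^sub>R (x :: real^'n)" for c x
    by (simp add: scaleR_matrix_vector_assoc[symmetric])
  show "transpose (c *\<^sub>R mat 1) = (c *\<^sub>R mat 1 :: real^'n^'n)"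
    by (auto simp: transpose_def mat_def vec_eq_iff)
  show "curvature_op \<xi> (c *\<^sub>R mat 1 :: real^'n^'n) = c * (real CARD('n) - (norm \<xi>)\<^sup>2)"
    unfolding curvature_op_alt 1 by (simp add: mat_def power2_norm_eq_inner algebra_simps)
  show "curvature_op \<xi> (X + Y) = curvature_op \<xi> X + curvature_op \<xi> Y"
    by (simp add: curvature_op_def distrib_left sum.distrib)
  show "curvature_op \<xi> (c *\<^sub>R X) = c * curvature_op \<xi> X"
    by (simp add: curvature_op_def sum_distrib_left algebra_simps)
qed

text \<open>The composition of the quadratic polynomial centred at \<open>p0\<close> with \<open>z \<mapsto> - exp (- K z) / K\<close>. For large
  \<open>K\<close> this increasing function is close to zero on positive \<open>z\<close> and very negative on negative \<open>z\<close>,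
  so it plays the role of a smooth indicator of the positive set.\<close>
definition barrier :: "real \<Rightarrow> (real^'n) \<times> real \<Rightarrow> real^'n \<Rightarrow> real^'n^'n \<Rightarrow> real \<Rightarrow> real
    \<Rightarrow> (real^'n) \<times> real \<Rightarrow> real" where
  "barrier K p0 b B c M p = - exp (- K * quad b B c M (p - p0)) / K"

lemma C_inf_on_barrier:
  fixes p0 :: "(real^'n) \<times> real"
  shows "C_inf_on UNIV (barrier K p0 b B c M)"
  unfolding C_inf_on_def
proof
  fix k
  have lin: "bounded_linear l \<Longrightarrow> C_k_on k UNIV (\<lambda>p. l (p - p0))"
    for l :: "(real^'n) \<times> real \<Rightarrow> real"
    using C_k_on_UNIV_add[OF C_k_on_UNIV_bounded_linear C_k_on_UNIV_const[of k "- l p0"], of l]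
    by (simp add: linear_simps)
  have L1: "C_k_on k UNIV (\<lambda>p. b \<bullet> fst (p - p0))"
    by (rule lin) (intro bounded_linear_intros)
  have L2: "C_k_on k UNIV (\<lambda>p. fst (p - p0) $ i)" for i
    by (rule lin) (intro bounded_linear_compose[OF bounded_linear_vec_nth] bounded_linear_fst)
  have L3: "C_k_on k UNIV (\<lambda>p. (B *v fst (p - p0)) $ i)" for i
    by (rule lin) (intro bounded_linear_compose[OF bounded_linear_vec_nth]
        bounded_linear_compose[OF matrix_vector_mul_bounded_linear] bounded_linear_fst)
  have L4: "C_k_on k UNIV (\<lambda>p. snd (p - p0))"
    by (rule lin) (rule bounded_linear_snd)
  have eq: "barrier K p0 b B c M = (\<lambda>p. - (1 / K) * exp (- K * (b \<bullet> fst (p - p0)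
      + (1 / 2) * (\<Sum>i\<in>UNIV. fst (p - p0) $ i * (B *v fst (p - p0)) $ i)
      + c * snd (p - p0) + (- M) * (snd (p - p0) * snd (p - p0)))))"
    by (simp add: barrier_def quad_def inner_vec_def power2_eq_square fun_eq_iff)
  show "C_k_on k UNIV (barrier K p0 b B c M)"
    unfolding eq
    by (intro C_k_on_UNIV_mult C_k_on_UNIV_const C_k_on_UNIV_exp C_k_on_UNIV_add C_k_on_UNIV_sum
        L1 L2 L3 L4)
qed

lemma symmetric_matrix_inner:
  fixes B :: "real^'n^'n"
  assumes "transpose B = B"
  shows "x \<bullet> (B *v y) = y \<bullet> (B *v x)"
  by (metis assms dot_lmul_matrix inner_commute vector_transpose_matrix)

lemma matrix_vector_mult_has_derivative:
  "((\<lambda>x. B *v (x - z)) has_derivative (\<lambda>h. B *v h)) (at (x::real^'n))"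
  by (rule has_derivative_eq_rhs[OF bounded_linear.has_derivative[OF matrix_vector_mul_bounded_linear
        has_derivative_diff[OF has_derivative_ident has_derivative_const]]]) simp

lemma barrier_derivatives:
  fixes B :: "real^'n^'n" and b :: "real^'n" and p0 p :: "(real^'n) \<times> real" and c M K :: real
  assumes "transpose B = B" "K > 0"
  defines "e \<equiv> exp (- K * quad b B c M (p - p0))" and "g \<equiv> b + B *v (fst p - fst p0)"
  shows "deriv_t (barrier K p0 b B c M) p = e * (c - 2 * M * (snd p - snd p0))"
    and "grad_x (barrier K p0 b B c M) p = e *\<^sub>R g"
    and "hess_x (barrier K p0 b B c M) p = (\<chi> i j. e * (B $ i $ j - K * g $ i * g $ j))"
proof -
  obtain z s where p0: "p0 = (z, s)" by (cases p0)
  obtain y t where p: "p = (y, t)" by (cases p)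
  define q where "q x = quad b B c M (x - z, t - s)" for x
  define G where "G x = b + B *v (x - z)" for x
  have dq: "(q has_derivative (\<lambda>h. h \<bullet> G x)) (at x)" for x
  proof (rule has_derivative_eq_rhs)
    show "(q has_derivative (\<lambda>h. b \<bullet> (h - 0)
        + ((x - z) \<bullet> (B *v h) + (h - 0) \<bullet> (B *v (x - z))) / 2 + 0 - 0)) (at x)"
      unfolding q_def quad_def fst_conv snd_conv divide_inverse
      by (intro has_derivative_add has_derivative_diff has_derivative_mult_left has_derivative_inner_right
          has_derivative_inner has_derivative_const has_derivative_ident
          matrix_vector_mult_has_derivative)
    show "(\<lambda>h. b \<bullet> (h - 0) + ((x - z) \<bullet> (B *v h) + (h - 0) \<bullet> (B *v (x - z))) / 2 + 0 - 0)
        = (\<lambda>h. h \<bullet> G x)"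
    proof
      fix h
      show "b \<bullet> (h - 0) + ((x - z) \<bullet> (B *v h) + (h - 0) \<bullet> (B *v (x - z))) / 2 + 0 - 0 = h \<bullet> G x"
        using symmetric_matrix_inner[OF assms(1), of "x - z" h]
        by (simp add: G_def inner_add_right inner_commute[of b h])
    qed
  qed
  have db: "((\<lambda>x. barrier K p0 b B c M (x, t)) has_derivative (\<lambda>h. exp (- (K * q x)) * (h \<bullet> G x))) (at x)" for x
    unfolding barrier_def p0 diff_Pair q_def[symmetric] mult_minus_left
    by (rule derivative_eq_intros dq refl)+ (use \<open>K > 0\<close> in \<open>auto simp: fun_eq_iff\<close>)
  then have pd: "partial_deriv i (\<lambda>x. barrier K p0 b B c M (x, t)) = (\<lambda>x. exp (- (K * q x)) * G x $ i)" for i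
    using partial_deriv_eq[OF db] by (simp add: fun_eq_iff inner_axis')
  have dG: "((\<lambda>x. G x $ i) has_derivative (\<lambda>h. (B *v h) $ i)) (at x)" for x i
    unfolding G_def
    by (rule has_derivative_eq_rhs[OF bounded_linear.has_derivative[OF bounded_linear_vec_nth
          has_derivative_add[OF has_derivative_const matrix_vector_mult_has_derivative]]]) simp
  have dd: "((\<lambda>x. exp (- (K * q x)) * G x $ i) has_derivative
      (\<lambda>h. exp (- (K * q x)) * ((B *v h) $ i - K * G x $ i * (h \<bullet> G x)))) (at x)" for x i
    by (rule derivative_eq_intros dq dG refl)+ (auto simp: fun_eq_iff algebra_simps)
  have pd2: "partial_deriv j (\<lambda>x. exp (- (K * q x)) * G x $ i) x
      = exp (- (K * q x)) * (B $ i $ j - K * G x $ i * G x $ j)" for i j x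
    using partial_deriv_eq[OF dd, of j i x]
    by (simp add: inner_axis' matrix_vector_mult_basis column_def)
  have e: "e = exp (- (K * q y))" and g: "g = G y"
    by (auto simp: e_def g_def q_def G_def p p0)
  show "grad_x (barrier K p0 b B c M) p = e *\<^sub>R g"
    by (simp add: grad_x_def gradient_def p pd e g vec_eq_iff)
  show "hess_x (barrier K p0 b B c M) p = (\<chi> i j. e * (B $ i $ j - K * g $ i * g $ j))"
    by (simp add: hess_x_def hessian_def p pd pd2 e g vec_eq_iff)
  have "((\<lambda>t. barrier K p0 b B c M (y, t)) has_real_derivative e * (c - 2 * M * (t - s))) (at t)"
    unfolding barrier_def p0 diff_Pair quad_def fst_conv snd_conv e_def p
    by (rule derivative_eq_intros refl)+ (use \<open>K > 0\<close> in \<open>auto simp: field_simps\<close>)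
  then show "deriv_t (barrier K p0 b B c M) p = e * (c - 2 * M * (snd p - snd p0))"
    by (simp add: deriv_t_def p p0 DERIV_imp_deriv)
qed

text \<open>The nonpositive set of \<open>w\<close> evolves like a subsolution of mean curvature flow: a quadratic
  polynomial that is strictly negative on it away from the contact point satisfies the curvature
  inequality at some point nearby. The contact with the set is turned into a contact with \<open>w\<close>
  itself by minimizing \<open>w - barrier\<close> over a small ball. On the boundary of the ball either \<open>w\<close> is
  bounded below by a positive number, or the polynomial is bounded above by a negative one; in both cases
  the difference exceeds its value at the centre when \<open>K\<close> is large. So the minimum is
  attained inside, and the barrier is an admissible test function there.\<close>
lemma nonpositive_set_touched_by_quad:
  fixes B :: "real^'n^'n"
  assumes super: "mcf_weak_supersolution w" and cont: "continuous_on (UNIV \<times> {0..}) w"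
    and sym: "transpose B = B" and "t0 > 0" "\<kappa> > 0" "\<rho> > 0" and w0: "w (z0, t0) \<le> 0"
    and touch: "\<forall>\<^sub>F p in nhds (z0, t0). w p \<le> 0 \<longrightarrow>
      quad b B c M (p - (z0, t0)) \<le> - \<kappa> * (norm (p - (z0, t0)))\<^sup>2"
  obtains x t \<xi> where "norm ((x, t) - (z0, t0)) < \<rho>" "norm \<xi> \<le> 1"
    "b + B *v (x - z0) \<noteq> 0 \<Longrightarrow> \<xi> = (b + B *v (x - z0)) /\<^sub>R norm (b + B *v (x - z0))"
    "curvature_op \<xi> B \<le> c - 2 * M * (t - t0)"
proof -
  define p0 where "p0 = (z0, t0)"
  define \<psi> where "\<psi> p = quad b B c M (p - p0)" for p
  obtain \<rho>1 where "\<rho>1 > 0" and \<rho>1: "\<And>p. dist p p0 < \<rho>1 \<Longrightarrow> w p \<le> 0 \<Longrightarrow> \<psi> p \<le> - \<kappa> * (dist p p0)\<^sup>2"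
    using touch unfolding eventually_nhds_metric p0_def[symmetric] \<psi>_def[symmetric] dist_norm by blast
  define \<sigma> where "\<sigma> = min (min \<rho> \<rho>1) t0 / 2"
  have \<sigma>: "0 < \<sigma>" "\<sigma> < \<rho>" "\<sigma> < \<rho>1" "\<sigma> < t0"
    using \<open>\<rho> > 0\<close> \<open>\<rho>1 > 0\<close> \<open>t0 > 0\<close> by (auto simp: \<sigma>_def)
  have time_pos: "snd p > 0" if "p \<in> cball p0 \<sigma>" for p
    using that dist_snd_le[of p0 p] \<sigma>(4) by (auto simp: p0_def dist_real_def)
  have cw: "continuous_on (cball p0 \<sigma>) w"
    by (rule continuous_on_subset[OF cont]) (use time_pos in \<open>force simp: less_imp_le\<close>)
  have c\<psi>: "continuous_on A \<psi>" for A
    unfolding \<psi>_def quad_def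
    by (intro continuous_intros matrix_vector_mult_linear_continuous_on
        continuous_on_compose2[OF matrix_vector_mult_linear_continuous_on]) auto
  obtain m where m: "\<And>p. p \<in> cball p0 \<sigma> \<Longrightarrow> - m \<le> w p" "m \<ge> 0"
  proof -
    have "bounded (w ` cball p0 \<sigma>)"
      by (intro compact_imp_bounded compact_continuous_image cw compact_cball)
    then obtain m where m: "\<forall>p\<in>cball p0 \<sigma>. \<bar>w p\<bar> \<le> m"
      by (auto simp: bounded_iff)
    then have "\<bar>w p0\<bar> \<le> m"
      using \<sigma>(1) by auto
    then show ?thesis
      using m by (intro that[of m]) (force simp: abs_le_iff)+
  qed
  define e where "e = \<kappa> * \<sigma>\<^sup>2 / 2"
  have "e > 0"
    using \<open>\<kappa> > 0\<close> \<sigma>(1) by (simp add: e_def)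
  obtain a where a: "a > 0" "\<And>p. p \<in> sphere p0 \<sigma> \<Longrightarrow> - e \<le> \<psi> p \<Longrightarrow> a \<le> w p"
  proof -
    let ?S = "sphere p0 \<sigma> \<inter> \<psi> -` {- e..}"
    have "compact ?S"
      by (intro compact_Int_closed compact_sphere continuous_closed_vimage)
        (use c\<psi>[of UNIV] in \<open>auto simp: continuous_on_eq_continuous_at\<close>)
    moreover have "continuous_on ?S w"
      by (rule continuous_on_subset[OF cw]) auto
    moreover have "w p > 0" if "p \<in> ?S" for p
    proof (rule ccontr)
      assume "\<not> w p > 0"
      then have "\<psi> p \<le> - \<kappa> * \<sigma>\<^sup>2"
        using \<rho>1[of p] that \<sigma> by (auto simp: dist_commute)
      then show False
        using that \<open>e > 0\<close> by (auto simp: e_def)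
    qed
    ultimately have "\<exists>a>0. \<forall>p\<in>?S. a \<le> w p"
      using continuous_attains_inf[of ?S w] by (metis empty_iff zero_less_one)
    then show ?thesis
      using that by auto
  qed
  \<comment> \<open>\<open>1 / a\<close> handles the part of the sphere where \<open>w \<ge> a\<close>. The last summand makes the quadratic term
    of \<open>exp (K e) / K\<close> alone exceed \<open>m\<close>, which handles the part where \<open>\<psi> < - e\<close>.\<close>
  define K where "K = 1 + 1 / a + 2 * m / e\<^sup>2"
  have "2 * m / e\<^sup>2 \<ge> 0"
    using m(2) by simp
  then have "1 / a < K" "K > 0"
    using a(1) by (auto simp: K_def add_pos_nonneg)
  then have K: "K > 0" "1 / K < a"
    using a(1) by (auto simp: field_simps)
  have Kexp: "m + 1 / K < exp (K * e) / K"
  proof -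
    have "2 * m / e\<^sup>2 \<le> K"
      using a(1) by (simp add: K_def)
    then have "m * K \<le> (K * e)\<^sup>2 / 2"
      using \<open>e > 0\<close> K(1) by (simp add: field_simps power2_eq_square)
    moreover have "K * e > 0"
      using K(1) \<open>e > 0\<close> by simp
    ultimately have "m * K + 1 < exp (K * e)"
      using exp_lower_Taylor_quadratic[of "K * e"] by linarith
    then have "(m * K + 1) / K < exp (K * e) / K"
      using K(1) by (simp add: divide_strict_right_mono)
    then show ?thesis
      using K(1) by (simp add: add_divide_distrib)
  qed
  define f where "f p = w p - barrier K p0 b B c M p" for p
  have f: "f p = w p + exp (- K * \<psi> p) / K" for p
    by (simp add: f_def barrier_def \<psi>_def)
  have f0: "f p0 \<le> 1 / K"
    using w0 by (simp add: f \<psi>_def quad_def p0_def zero_prod_def[symmetric])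
  have f_sphere: "f p > 1 / K" if "p \<in> sphere p0 \<sigma>" for p
  proof (cases "- e \<le> \<psi> p")
    case True
    moreover have "exp (- K * \<psi> p) / K > 0"
      using K(1) by simp
    ultimately show ?thesis
      unfolding f using a(2)[OF that] K(2) by linarith
  next
    case False
    then have "K * e < K * - \<psi> p"
      using K(1) by (intro mult_strict_left_mono) auto
    then have "exp (K * e) / K < exp (- K * \<psi> p) / K"
      using K(1) by (simp add: divide_strict_right_mono)
    moreover have "- m \<le> w p"
      using m(1) that by simp
    ultimately show ?thesis
      unfolding f using Kexp by linarith
  qed
  have "continuous_on (cball p0 \<sigma>) f"
    unfolding f using K(1) by (intro continuous_intros cw c\<psi>) auto
  then obtain q where q: "q \<in> cball p0 \<sigma>" "\<And>p. p \<in> cball p0 \<sigma> \<Longrightarrow> f q \<le> f p"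
    using continuous_attains_inf[of "cball p0 \<sigma>" f] \<sigma>(1) by (metis cball_eq_empty compact_cball not_less_iff_gr_or_eq)
  have "f q \<le> 1 / K"
    using q(2)[of p0] f0 \<sigma>(1) by simp
  then have q_ball: "q \<in> ball p0 \<sigma>"
    using f_sphere[of q] q(1) by fastforce
  obtain x t where xt: "q = (x, t)" by (cases q)
  have "\<forall>\<^sub>F p in nhds q. f q \<le> f p"
    unfolding eventually_nhds using q_ball q(2) open_ball[of p0 \<sigma>] ball_subset_cball[of p0 \<sigma>] by blast
  then have lm: "local_min_at (\<lambda>p. w p - barrier K p0 b B c M p) (x, t)"
    by (simp add: local_min_at_def f_def[symmetric] xt)
  have "t > 0"
    using time_pos[OF q(1)] by (simp add: xt)
  define E where "E = exp (- K * quad b B c M (q - p0))"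
  define g where "g = b + B *v (x - z0)"
  have "E > 0" by (simp add: E_def)
  note d = barrier_derivatives[OF sym K(1), where b = b and c = c and M = M and p = q and ?p0.0 = p0, folded E_def, unfolded xt p0_def fst_conv snd_conv,
      folded g_def p0_def]
  have t: "(if E *\<^sub>R g \<noteq> 0
        then E * (c - 2 * M * (t - t0)) \<ge> curvature_op ((E *\<^sub>R g) /\<^sub>R norm (E *\<^sub>R g)) (\<chi> i j. E * (B $ i $ j - K * g $ i * g $ j))
        else \<exists>\<xi>. norm \<xi> \<le> 1 \<and> E * (c - 2 * M * (t - t0)) \<ge> curvature_op \<xi> (\<chi> i j. E * (B $ i $ j - K * g $ i * g $ j)))"
    using super[unfolded mcf_weak_supersolution_def, rule_format, of "barrier K p0 b B c M" t x]
      C_inf_on_barrier[of K p0 b B c M] \<open>t > 0\<close> lm unfolding d by simp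
  have "\<exists>\<xi>. norm \<xi> \<le> 1 \<and> (g \<noteq> 0 \<longrightarrow> \<xi> = g /\<^sub>R norm g) \<and> curvature_op \<xi> B \<le> c - 2 * M * (t - t0)"
  proof (cases "g = 0")
    case True
    then show ?thesis
      using t[unfolded curvature_op_rank_one_update] \<open>E > 0\<close> by auto
  next
    case False
    define \<xi> where "\<xi> = g /\<^sub>R norm g"
    have 1: "(E *\<^sub>R g) /\<^sub>R norm (E *\<^sub>R g) = \<xi>"
      using False \<open>E > 0\<close> by (simp add: \<xi>_def field_simps)
    have "g \<bullet> \<xi> = norm g"
      using False by (simp add: \<xi>_def dot_square_norm power2_eq_square)
    then have 2: "g \<bullet> g - (g \<bullet> \<xi>)\<^sup>2 = 0"
      by (simp add: dot_square_norm)
    have 3: "E *\<^sub>R g \<noteq> 0"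
      using False \<open>E > 0\<close> by simp
    have "curvature_op \<xi> B \<le> c - 2 * M * (t - t0)"
      using t \<open>E > 0\<close> unfolding if_P[OF 3] 1 curvature_op_rank_one_update 2 by simp
    moreover have "norm \<xi> \<le> 1"
      using False by (simp add: \<xi>_def)
    ultimately show ?thesis
      unfolding \<xi>_def by blast
  qed
  moreover have "norm ((x, t) - (z0, t0)) < \<rho>"
    using q_ball \<sigma>(2) unfolding dist_norm[symmetric] by (simp add: xt p0_def dist_commute)
  ultimately show ?thesis
    using that unfolding g_def by blast
qed

text \<open>With a nonzero gradient at the contact point the curvature inequality depends continuously on the
  point, so it passes to the limit from the nearby points.\<close>
lemma nonpositive_set_touched_by_quad_noncritical:
  fixes B :: "real^'n^'n"
  assumes super: "mcf_weak_supersolution w" and cont: "continuous_on (UNIV \<times> {0..}) w"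
    and sym: "transpose B = B" and "t0 > 0" "\<kappa> > 0" and w0: "w (z0, t0) \<le> 0"
    and touch: "\<forall>\<^sub>F p in nhds (z0, t0). w p \<le> 0 \<longrightarrow>
      quad b B c M (p - (z0, t0)) \<le> - \<kappa> * (norm (p - (z0, t0)))\<^sup>2"
    and "b \<noteq> 0"
  shows "curvature_op (b /\<^sub>R norm b) B \<le> c"
proof (rule ccontr)
  assume neg: "\<not> ?thesis"
  define g where "g q = b + B *v fst q" for q :: "(real^'n) \<times> real"
  define F where "F q = curvature_op (g q /\<^sub>R norm (g q)) B - (c - 2 * M * snd q)" for q
  have lfst: "((\<lambda>q. B *v fst q) \<longlongrightarrow> B *v 0) (nhds (0 :: (real^'n) \<times> real))" 
    by (rule bounded_linear.tendsto[OF matrix_vector_mul_bounded_linear])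
      (use tendsto_fst[where f = "\<lambda>q. q", OF filterlim_ident, of "0 :: (real^'n) \<times> real"] in simp)
  have g: "(g \<longlongrightarrow> b) (nhds 0)"
    using tendsto_add[OF tendsto_const lfst, of b] by (simp add: g_def[abs_def])
  then have n: "((\<lambda>q. g q /\<^sub>R norm (g q)) \<longlongrightarrow> b /\<^sub>R norm b) (nhds 0)"
    using \<open>b \<noteq> 0\<close> by (intro tendsto_intros) auto
  have "(F \<longlongrightarrow> curvature_op (b /\<^sub>R norm b) B - (c - 2 * M * 0)) (nhds 0)"
    unfolding F_def curvature_op_alt
    by (intro tendsto_diff tendsto_const tendsto_inner n tendsto_mult
        bounded_linear.tendsto[OF matrix_vector_mul_bounded_linear])
      (use tendsto_snd[where f = "\<lambda>q. q", OF filterlim_ident, of "0 :: (real^'n) \<times> real"] in simp)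
  then have "\<forall>\<^sub>F q in nhds 0. F q > 0"
    by (rule order_tendstoD) (use neg in simp)
  moreover have "\<forall>\<^sub>F q in nhds 0. g q \<noteq> 0"
    using tendsto_imp_eventually_ne[OF g \<open>b \<noteq> 0\<close>] .
  ultimately have "\<forall>\<^sub>F q in nhds 0. F q > 0 \<and> g q \<noteq> 0"
    by eventually_elim simp
  then obtain \<rho> where "\<rho> > 0" and \<rho>: "\<And>q. norm q < \<rho> \<Longrightarrow> F q > 0 \<and> g q \<noteq> 0"
    unfolding eventually_nhds_metric by (auto simp: dist_norm)
  obtain x t \<xi> where l: "norm ((x, t) - (z0, t0)) < \<rho>"
    "b + B *v (x - z0) \<noteq> 0 \<Longrightarrow> \<xi> = (b + B *v (x - z0)) /\<^sub>R norm (b + B *v (x - z0))"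
    "curvature_op \<xi> B \<le> c - 2 * M * (t - t0)"
    using nonpositive_set_touched_by_quad[OF super cont sym \<open>t0 > 0\<close> \<open>\<kappa> > 0\<close> \<open>\<rho> > 0\<close> w0 touch] by metis
  show False
    using \<rho>[OF l(1)] l(2,3) by (auto simp: F_def g_def)
qed

text \<open>If the shrinking paraboloid \<open>\<Psi> > 0\<close> met the nonpositive set, the latter would be touched
  at a maximum point of \<open>\<Psi>\<close>. There the curvature inequality fails because the
  radius shrinks faster than under mean curvature flow. The speed constant leaves room for the apex, where the
  gradient vanishes and the normal is an arbitrary vector of length at most one, and for the strictness
  that the touching lemma demands.\<close>
lemma positive_ball_persists:
  fixes w :: "(real^'n) \<times> real \<Rightarrow> real"
  assumes super: "mcf_weak_supersolution w" and cont: "continuous_on (UNIV \<times> {0..}) w"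
    and "0 < s" and pos: "\<And>x. norm (x - x0) < R \<Longrightarrow> w (x, s) > 0"
    and "s \<le> t1" and x1: "(norm (x1 - x0))\<^sup>2 + (4 * real CARD('n) + 3) * (t1 - s) < R\<^sup>2" and "R > 0"
  shows "w (x1, t1) > 0"
proof (rule ccontr)
  assume neg: "\<not> w (x1, t1) > 0"
  define C where "C = 4 * real CARD('n) + 3"
  have "C > 0" by (simp add: C_def)
  define \<Psi> where "\<Psi> p = R\<^sup>2 - (norm (fst p - x0))\<^sup>2 - C * (snd p - s)" for p :: "(real^'n) \<times> real"
  define Q where "Q = cball x0 R \<times> {s..s + R\<^sup>2 / C}"
  define P where "P = Q \<inter> w -` {..0} \<inter> \<Psi> -` {0..}"
  have c\<Psi>: "continuous_on A \<Psi>" for A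
    unfolding \<Psi>_def by (intro continuous_intros)
  have "closed (Q \<inter> w -` {..0})" and cQ: "compact Q"
    using \<open>0 < s\<close> unfolding Q_def
    by (auto intro!: continuous_closed_preimage continuous_on_subset[OF cont] closed_Times compact_Times)
  then have "compact (Q \<inter> w -` {..0})"
    using compact_Int_closed[of Q "Q \<inter> w -` {..0}"] by (simp add: Int_assoc[symmetric])
  moreover have "closed (\<Psi> -` {0..})"
    by (rule continuous_closed_vimage)
      (use c\<Psi>[of UNIV] in \<open>auto simp: continuous_on_eq_continuous_at\<close>)
  ultimately have "compact ((Q \<inter> w -` {..0}) \<inter> \<Psi> -` {0..})"
    by (rule compact_Int_closed)
  then have "compact P" by (simp add: P_def)
  have P_iff: "p \<in> P" if "snd p \<ge> s" "w p \<le> 0" "\<Psi> p \<ge> 0" for p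
  proof -
    have "(norm (fst p - x0))\<^sup>2 + C * (snd p - s) \<le> R\<^sup>2" "C * (snd p - s) \<ge> 0"
      using that \<open>C > 0\<close> by (auto simp: \<Psi>_def)
    then have "(norm (fst p - x0))\<^sup>2 \<le> R\<^sup>2" "C * (snd p - s) \<le> R\<^sup>2"
      using zero_le_power2[of "norm (fst p - x0)"] by linarith+
    then have "norm (fst p - x0) \<le> R" "snd p \<le> s + R\<^sup>2 / C"
      using \<open>R > 0\<close> \<open>C > 0\<close> by (auto intro: power2_le_imp_le simp: field_simps)
    then show ?thesis
      using that by (cases p) (auto simp: P_def Q_def dist_norm norm_minus_commute)
  qed
  have \<Psi>1: "\<Psi> (x1, t1) > 0"
    using x1 by (simp add: \<Psi>_def C_def)
  then have "(x1, t1) \<in> P"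
    using neg \<open>s \<le> t1\<close> by (intro P_iff) auto
  then obtain q where q: "q \<in> P" "\<And>p. p \<in> P \<Longrightarrow> \<Psi> p \<le> \<Psi> q"
    using continuous_attains_sup[OF \<open>compact P\<close> _ c\<Psi>] by blast
  obtain z t where zt: "q = (z, t)" by (cases q)
  have "\<Psi> q > 0"
    using q(2)[OF \<open>(x1, t1) \<in> P\<close>] \<Psi>1 by simp
  have wq: "w (z, t) \<le> 0" and "s \<le> t"
    using q(1) by (auto simp: P_def Q_def zt)
  have "s \<noteq> t"
  proof
    assume "s = t"
    then have "(norm (z - x0))\<^sup>2 < R\<^sup>2"
      using \<open>\<Psi> q > 0\<close> by (simp add: \<Psi>_def zt)
    then have "norm (z - x0) < R"
      using \<open>R > 0\<close> by (auto intro: power2_less_imp_less)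
    then show False
      using pos[of z] wq \<open>s = t\<close> by simp
  qed
  with \<open>s \<le> t\<close> have "s < t" by simp
  \<comment> \<open>The Hessian of \<open>\<Psi>\<close> is \<open>-2\<close> times the identity. Another \<open>-2\<close>, and the coefficient \<open>1\<close> of the square
    in time, make the contact strict.\<close>
  define b where "b = (- 2) *\<^sub>R (z - x0)"
  define B :: "real^'n^'n" where "B = (- 4) *\<^sub>R mat 1"
  have \<Psi>_eq: "quad b B (- C) 1 (p - (z, t)) = \<Psi> p - \<Psi> q - (norm (p - (z, t)))\<^sup>2" for p
  proof -
    obtain y u where p: "p = (y, u)" by (cases p)
    have n: "(norm (y - z, u - t))\<^sup>2 = (norm (y - z))\<^sup>2 + (u - t)\<^sup>2"
      by (simp add: norm_Pair)
    show ?thesis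
      unfolding p quad_def B_def b_def \<Psi>_def zt diff_Pair n fst_conv snd_conv diff_Pair scaled_identity_simps
      by (simp add: power2_norm_eq_inner inner_diff_left inner_diff_right inner_commute algebra_simps)
        (simp add: field_simps)
  qed
  have "\<forall>\<^sub>F p in nhds (z, t). snd p > s"
    by (rule order_tendstoD[where y = t]) (use \<open>s < t\<close> tendsto_snd[OF filterlim_ident, of "(z,t)"] in auto)
  then have "\<forall>\<^sub>F p in nhds (z, t). w p \<le> 0 \<longrightarrow>
      quad b B (- C) 1 (p - (z, t)) \<le> - 1 * (norm (p - (z, t)))\<^sup>2"
  proof eventually_elim
    case (elim p)
    have "\<Psi> p \<le> \<Psi> q" if "w p \<le> 0"
      using elim that q(2)[of p] P_iff[of p] \<open>\<Psi> q > 0\<close> by linarith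
    then show ?case
      unfolding \<Psi>_eq by auto
  qed
  moreover have "transpose B = B"
    unfolding B_def by (rule scaled_identity_simps(2))
  moreover have "0 < t"
    using \<open>0 < s\<close> \<open>s < t\<close> by simp
  ultimately obtain x' t' \<xi> where l: "norm ((x', t') - (z, t)) < 1" "norm \<xi> \<le> 1"
      "curvature_op \<xi> B \<le> - C - 2 * 1 * (t' - t)"
    using nonpositive_set_touched_by_quad[OF super cont _ _ zero_less_one zero_less_one wq, of B b "- C" 1]
    by blast
  have "\<bar>t' - t\<bar> < 1"
    using l(1) norm_snd_le[where x = "x' - z" and y = "t' - t"] by simp
  moreover have "curvature_op \<xi> B \<ge> - 4 * real CARD('n)"
    unfolding B_def scaled_identity_simps(3)[of \<xi> "- 4"] by simp
  ultimately show False
    using l(3) by (simp add: C_def)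
qed

section \<open>The cut-off profile\<close>

text \<open>The first two derivatives of \<open>eta\<close>. In the variable \<open>x = 4 z / \<delta> - 1\<close> the first one
  is the smoothstep \<open>3 x\<^sup>2 - 2 x\<^sup>3\<close> between \<open>0\<close> and \<open>1\<close>.\<close>
definition eta_deriv :: "real \<Rightarrow> real \<Rightarrow> real" where
  "eta_deriv \<delta> z = (if z \<le> \<delta> / 4 then 0
     else if z \<le> \<delta> / 2 then - 128 / \<delta>^3 * z^3 + 144 / \<delta>^2 * z^2 - 48 / \<delta> * z + 5 else 1)"

definition eta_deriv2 :: "real \<Rightarrow> real \<Rightarrow> real" where
  "eta_deriv2 \<delta> z = (if z \<le> \<delta> / 4 then 0
     else if z \<le> \<delta> / 2 then - 384 / \<delta>^3 * z^2 + 288 / \<delta>^2 * z - 48 / \<delta> else 0)"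

lemma has_real_derivative_glue:
  fixes f g :: "real \<Rightarrow> real"
  assumes f: "\<And>x. x \<le> a \<Longrightarrow> (f has_real_derivative f' x) (at x)"
    and g: "\<And>x. a \<le> x \<Longrightarrow> (g has_real_derivative g' x) (at x)"
    and "f a = g a" "f' a = g' a"
  shows "((\<lambda>x. if x \<le> a then f x else g x) has_real_derivative (if x \<le> a then f' x else g' x)) (at x)"
proof -
  let ?h = "\<lambda>x. if x \<le> a then f x else g x"
  consider "x < a" | "a < x" | "x = a" by linarith
  then show ?thesis
  proof cases
    case 1
    then show ?thesis
      using f[of x] by (auto intro: has_field_derivative_transform_within_open[where S = "{..<a}"])
  next
    case 2
    then show ?thesis
      using g[of x] by (auto intro: has_field_derivative_transform_within_open[where S = "{a<..}"])
  next
    case 3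
    have "((\<lambda>y. (?h y - ?h a) / (y - a)) \<longlongrightarrow> f' a) (at a)"
    proof (rule filterlim_split_at)
      have "((\<lambda>y. (f y - f a) / (y - a)) \<longlongrightarrow> f' a) (at_left a)"
        using f[of a] by (auto simp: has_field_derivative_iff intro: filterlim_at_split[THEN iffD1, THEN conjunct1])
      then show "((\<lambda>y. (?h y - ?h a) / (y - a)) \<longlongrightarrow> f' a) (at_left a)"
        by (rule Lim_transform_eventually) (auto simp: eventually_at_filter)
      have "((\<lambda>y. (g y - g a) / (y - a)) \<longlongrightarrow> g' a) (at_right a)"
        using g[of a] by (auto simp: has_field_derivative_iff intro: filterlim_at_split[THEN iffD1, THEN conjunct2])
      then show "((\<lambda>y. (?h y - ?h a) / (y - a)) \<longlongrightarrow> f' a) (at_right a)"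
        unfolding assms(4) by (rule Lim_transform_eventually) (auto simp: eventually_at_filter assms(3))
    qed
    then show ?thesis
      using 3 by (simp add: has_field_derivative_iff)
  qed
qed

lemma eta_has_derivative:
  assumes "\<delta> > 0"
  shows "(eta \<delta> has_real_derivative eta_deriv \<delta> z) (at z)"
  unfolding eta_def[abs_def] eta_deriv_def
proof (rule has_real_derivative_glue[where f = "\<lambda>_. - 5 / 8 * \<delta>" and f' = "\<lambda>_. 0"], goal_cases)
  case (2 x)
  show ?case
    by (rule has_real_derivative_glue, goal_cases)
      (use \<open>\<delta> > 0\<close> in \<open>auto intro!: derivative_eq_intros simp: field_simps power2_eq_square eval_nat_numeral\<close>)
qed (use \<open>\<delta> > 0\<close> in \<open>auto simp: field_simps eval_nat_numeral\<close>)

lemma eta_deriv_has_derivative: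
  assumes "\<delta> > 0"
  shows "(eta_deriv \<delta> has_real_derivative eta_deriv2 \<delta> z) (at z)"
  unfolding eta_deriv_def[abs_def] eta_deriv2_def
proof (rule has_real_derivative_glue[where f = "\<lambda>_. 0" and f' = "\<lambda>_. 0"], goal_cases)
  case (2 x)
  show ?case
    by (rule has_real_derivative_glue, goal_cases)
      (use \<open>\<delta> > 0\<close> in \<open>auto intro!: derivative_eq_intros simp: field_simps power2_eq_square eval_nat_numeral\<close>)
qed (use \<open>\<delta> > 0\<close> in \<open>auto simp: field_simps eval_nat_numeral\<close>)

lemma eta_slopes:
  assumes "\<delta> > 0"
  obtains x where "0 \<le> x" "x \<le> 1" "eta_deriv \<delta> z = x\<^sup>2 * (3 - 2 * x)" "eta_deriv2 \<delta> z = 24 / \<delta> * (x * (1 - x))"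
    "z > \<delta> / 4 \<Longrightarrow> x > 0"
proof (cases "\<delta> / 4 < z \<and> z \<le> \<delta> / 2")
  case True
  define x where "x = 4 * z / \<delta> - 1"
  have z: "z = \<delta> * (1 + x) / 4"
    using assms by (simp add: x_def)
  show ?thesis
  proof (rule that[of x])
    show "0 \<le> x" "x \<le> 1" "z > \<delta> / 4 \<Longrightarrow> x > 0"
      using True assms by (auto simp: x_def field_simps)
    have "eta_deriv \<delta> z = - 128 / \<delta>^3 * z^3 + 144 / \<delta>^2 * z^2 - 48 / \<delta> * z + 5"
      using True by (simp add: eta_deriv_def)
    also have "\<dots> = - 2 * (1 + x)^3 + 9 * (1 + x)^2 - 12 * (1 + x) + 5"
      unfolding z using assms by (simp add: power_mult_distrib power_divide) (simp add: add_divide_distrib)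
    also have "\<dots> = x\<^sup>2 * (3 - 2 * x)"
      by (simp add: power2_eq_square power3_eq_cube algebra_simps)
    finally show "eta_deriv \<delta> z = x\<^sup>2 * (3 - 2 * x)" .
    have "eta_deriv2 \<delta> z = - 384 / \<delta>^3 * z^2 + 288 / \<delta>^2 * z - 48 / \<delta>"
      using True by (simp add: eta_deriv2_def)
    also have "\<dots> = (- 24 * (1 + x)^2 + 72 * (1 + x) - 48) / \<delta>"
      unfolding z using assms by (simp add: power2_eq_square power3_eq_cube field_simps)
    also have "\<dots> = 24 / \<delta> * (x * (1 - x))"
      by (simp add: power2_eq_square algebra_simps diff_divide_distrib add_divide_distrib)
    finally show "eta_deriv2 \<delta> z = 24 / \<delta> * (x * (1 - x))" .
  qed
next
  case False
  then show ?thesis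
    using that[of "if z \<le> \<delta> / 4 then 0 else 1"] assms by (auto simp: eta_deriv_def eta_deriv2_def)
qed

lemma eta_deriv_nonneg: "\<delta> > 0 \<Longrightarrow> eta_deriv \<delta> z \<ge> 0"
  by (rule eta_slopes[of \<delta> z]) auto

lemma eta_deriv_le_1:
  assumes "\<delta> > 0" shows "eta_deriv \<delta> z \<le> 1"
proof -
  obtain x where x: "0 \<le> x" "x \<le> 1" "eta_deriv \<delta> z = x\<^sup>2 * (3 - 2 * x)"
    using eta_slopes[OF assms, of z] by metis
  have "1 - x\<^sup>2 * (3 - 2 * x) = (1 - x)\<^sup>2 * (1 + 2 * x)"
    by (simp add: power2_eq_square algebra_simps)
  then show ?thesis
    using x by (smt (verit) mult_nonneg_nonneg zero_le_power2)
qed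

lemma eta_deriv_pos: "\<delta> > 0 \<Longrightarrow> z > \<delta> / 4 \<Longrightarrow> eta_deriv \<delta> z > 0"
  by (rule eta_slopes[of \<delta> z]) auto

lemma eta_mono:
  assumes "\<delta> > 0" "y \<le> z"
  shows "eta \<delta> y \<le> eta \<delta> z"
  by (rule DERIV_nonneg_imp_nondecreasing[OF assms(2)])
    (use eta_has_derivative[OF assms(1)] eta_deriv_nonneg[OF assms(1)] in blast)

lemma eta_eq_left: "z \<le> \<delta> / 4 \<Longrightarrow> eta \<delta> z = - 5 / 8 * \<delta>"
  by (simp add: eta_def)

lemma eta_le_middle:
  assumes "\<delta> > 0" "z \<le> \<delta> / 2"
  shows "eta \<delta> z \<le> - \<delta> / 2"
proof -
  have "eta \<delta> (\<delta> / 2) = - \<delta> / 2"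
    using assms(1) by (simp add: eta_def field_simps eval_nat_numeral)
  then show ?thesis
    using eta_mono[OF assms] by simp
qed

text \<open>Put \<open>u = 1 - x\<close> with \<open>x\<close> the smoothstep variable. Then \<open>1 - \<eta>'\<^sup>2 \<ge> u\<^sup>2\<close> and \<open>\<eta>'' \<le> 24 u / \<delta>\<close>, so
  the claim follows from \<open>24 u / \<delta> \<le> c + 144 u\<^sup>2 / (c \<delta>\<^sup>2)\<close>, the arithmetic-geometric mean inequality.\<close>
lemma eta_curvature_absorbed:
  assumes "\<delta> > 0" "c > 0" and \<mu>: "\<mu> \<ge> 288 / (c * \<delta>\<^sup>2)"
  shows "eta_deriv2 \<delta> z - c \<le> \<mu> / 2 * (1 - (eta_deriv \<delta> z)\<^sup>2)"
proof -
  obtain x where x: "0 \<le> x" "x \<le> 1" "eta_deriv \<delta> z = x\<^sup>2 * (3 - 2 * x)" "eta_deriv2 \<delta> z = 24 / \<delta> * (x * (1 - x))"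
    using eta_slopes[OF assms(1), of z] by metis
  define u where "u = 1 - x"
  have "\<mu> > 0"
    using \<mu> assms by (smt (verit) divide_pos_pos mult_pos_pos zero_less_power)
  have "u\<^sup>2 \<le> u\<^sup>2 * (1 + 2 * x)"
    using x by (simp add: algebra_simps)
  also have "\<dots> = 1 - eta_deriv \<delta> z"
    unfolding x(3) by (simp add: u_def power2_eq_square algebra_simps)
  also have "\<dots> \<le> 1 - (eta_deriv \<delta> z)\<^sup>2"
    using eta_deriv_le_1[OF assms(1)] eta_deriv_nonneg[OF assms(1)] by (simp add: power2_eq_square mult_left_le)
  finally have 1: "\<mu> / 2 * u\<^sup>2 \<le> \<mu> / 2 * (1 - (eta_deriv \<delta> z)\<^sup>2)"
    using \<open>\<mu> > 0\<close> by (intro mult_left_mono) auto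
  have "eta_deriv2 \<delta> z = 24 / \<delta> * (x * u)"
    by (simp add: x(4) u_def)
  also have "\<dots> \<le> 24 / \<delta> * u"
    using x assms(1) by (intro mult_left_mono mult_left_le_one_le) (auto simp: u_def)
  finally have 2: "eta_deriv2 \<delta> z \<le> 24 / \<delta> * u" .
  have "24 / \<delta> * u \<le> c + 144 / (c * \<delta>\<^sup>2) * u\<^sup>2"
  proof -
    have "0 \<le> c * (1 - 12 / (c * \<delta>) * u)\<^sup>2"
      using assms by simp
    also have "\<dots> = c + 144 / (c * \<delta>\<^sup>2) * u\<^sup>2 - 24 / \<delta> * u"
      using assms by (simp add: power2_eq_square field_simps)
    finally show ?thesis by simp
  qed
  also have "144 / (c * \<delta>\<^sup>2) * u\<^sup>2 \<le> \<mu> / 2 * u\<^sup>2"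
    using \<mu> by (intro mult_right_mono) auto
  finally show ?thesis
    using 1 2 by linarith
qed

lemma eta_taylor:
  assumes "\<delta> > 0" "\<epsilon> > 0"
  shows "\<forall>\<^sub>F s in nhds 0. eta \<delta> (d + s) \<le> eta \<delta> d + s * eta_deriv \<delta> d + s\<^sup>2 / 2 * eta_deriv2 \<delta> d + \<epsilon> * s\<^sup>2"
proof -
  have shift: "((\<lambda>s. f (d + s)) has_derivative (\<lambda>h. h * D)) (at s)"
    if "(f has_real_derivative D) (at (d + s))" for f D s
  proof -
    have "(\<lambda>h. h * D) = (*) D"
      by (simp add: fun_eq_iff)
    then show ?thesis
      using that DERIV_shift[of f D s d] by (simp add: has_field_derivative_def add.commute[of d])
  qed
  have "((\<lambda>s. eta \<delta> (d + s)) has_derivative (\<lambda>h. h \<bullet> eta_deriv \<delta> (d + s))) (at s)" for s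
    using shift[OF eta_has_derivative[OF assms(1)]] by simp
  moreover have "((\<lambda>s. eta_deriv \<delta> (d + s)) has_derivative (\<lambda>h. h * eta_deriv2 \<delta> d)) (at 0)"
    using shift[OF eta_deriv_has_derivative[OF assms(1)], of 0] by simp
  ultimately have "\<forall>\<^sub>F s in nhds 0. \<bar>eta \<delta> (d + s) - (eta \<delta> (d + 0) + s \<bullet> eta_deriv \<delta> (d + 0) + (s \<bullet> (s * eta_deriv2 \<delta> d)) / 2)\<bar>
      \<le> \<epsilon> * (norm s)\<^sup>2"
    by (intro second_order_taylor_peano assms(2)) auto
  then show ?thesis
    by eventually_elim (simp add: abs_le_iff power2_eq_square algebra_simps)
qed

section \<open>Jets of the moving distance profile\<close>

lemma slope_nonpos_of_quadratic_bound:
  fixes a C :: real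
  assumes "\<forall>\<^sub>F s in at_right 0. s * a \<le> C * s\<^sup>2"
  shows "a \<le> 0"
proof (rule tendsto_lowerbound)
  show "((\<lambda>s. C * s) \<longlongrightarrow> 0) (at_right 0)"
    by (rule tendsto_eq_intros refl)+ simp
  have "\<forall>\<^sub>F s::real in at_right 0. s > 0"
    by (simp add: eventually_at_filter)
  with assms show "\<forall>\<^sub>F s in at_right 0. a \<le> C * s"
    by eventually_elim (simp add: power2_eq_square mult.commute[of _ a] mult.assoc[symmetric])
qed simp

text \<open>The first and second order necessary conditions at a maximum, for a quadratic germ known up
  to \<open>o(s\<^sup>2)\<close>.\<close>
lemma quadratic_nonpos:
  fixes a b :: real
  assumes "\<And>\<epsilon>. \<epsilon> > 0 \<Longrightarrow> \<forall>\<^sub>F s in nhds 0. s * a + s\<^sup>2 * b \<le> \<epsilon> * s\<^sup>2"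
  shows "a = 0" "b \<le> 0"
proof -
  have R: "\<forall>\<^sub>F s in at_right 0. P s" if "\<forall>\<^sub>F s in nhds (0::real). P s" for P
    using that by (simp add: eventually_at_filter eventually_mono)
  have L: "\<forall>\<^sub>F s in at_right 0. P (- s)" if "\<forall>\<^sub>F s in nhds (0::real). P s" for P
  proof -
    have "((\<lambda>s::real. - s) \<longlongrightarrow> - 0) (at_right 0)"
      by (intro tendsto_intros)
    then show ?thesis
      using that by (simp add: filterlim_iff)
  qed
  have "\<forall>\<^sub>F s in at_right 0. s * a \<le> (1 - b) * s\<^sup>2"
    using R[OF assms[OF zero_less_one]] by eventually_elim (simp add: algebra_simps)
  then have "a \<le> 0"
    by (rule slope_nonpos_of_quadratic_bound)
  moreover have "\<forall>\<^sub>F s in at_right 0. s * (- a) \<le> (1 - b) * s\<^sup>2"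
    using L[OF assms[OF zero_less_one]] by eventually_elim (simp add: algebra_simps)
  then have "- a \<le> 0"
    by (rule slope_nonpos_of_quadratic_bound)
  ultimately show "a = 0" by simp
  show "b \<le> 0"
  proof (rule field_le_epsilon)
    fix \<epsilon> :: real assume "\<epsilon> > 0"
    have "\<forall>\<^sub>F s::real in at_right 0. s > 0"
      by (simp add: eventually_at_filter)
    moreover have "\<forall>\<^sub>F s in at_right 0. s * a + s\<^sup>2 * b \<le> \<epsilon> * s\<^sup>2"
      using R[OF assms[OF \<open>\<epsilon> > 0\<close>]] .
    ultimately have "\<forall>\<^sub>F s::real in at_right 0. b \<le> \<epsilon>"
      by eventually_elim (simp add: \<open>a = 0\<close> mult.commute)
    then show "b \<le> 0 + \<epsilon>" by simp
  qed
qed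

text \<open>The positive part of the signed distance as long as the front is not empty. The distance to the
  whole nonpositive set is easier to control than the distance to the front.\<close>
definition inner_dist :: "((real^'n) \<times> real \<Rightarrow> real) \<Rightarrow> (real^'n) \<times> real \<Rightarrow> real" where
  "inner_dist w p = infdist (fst p) {x. w (x, snd p) \<le> 0}"

definition moving_profile :: "real \<Rightarrow> real \<Rightarrow> ((real^'n) \<times> real \<Rightarrow> real) \<Rightarrow> (real^'n) \<times> real \<Rightarrow> real" where
  "moving_profile \<delta> c w p = eta \<delta> (inner_dist w p) + c * snd p"

locale level_set_supersolution =
  fixes w :: "(real^'n) \<times> real \<Rightarrow> real"
  assumes super: "mcf_weak_supersolution w"
    and cont: "continuous_on (UNIV \<times> {0..}) w"
    and ex_nonpos: "t \<ge> 0 \<Longrightarrow> \<exists>x. w (x, t) \<le> 0"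
begin

lemma inner_dist_le:
  assumes "w (z, t) \<le> 0" shows "inner_dist w (x, t) \<le> norm (x - z)"
  using infdist_le[of z "{x. w (x, t) \<le> 0}" x] assms by (simp add: inner_dist_def dist_norm)

lemma inner_dist_nonneg: "inner_dist w p \<ge> 0"
  by (simp add: inner_dist_def infdist_nonneg)

lemma inner_dist_lipschitz: "inner_dist w (x + y, t) \<le> inner_dist w (x, t) + norm y"
  using infdist_triangle[of "x + y" "{x. w (x, t) \<le> 0}" x] by (simp add: inner_dist_def dist_norm)

lemma inner_dist_attained:
  assumes "t \<ge> 0"
  obtains z where "w (z, t) \<le> 0" "inner_dist w (x, t) = norm (x - z)"
proof -
  have "continuous_on UNIV (\<lambda>x. w (x, t))"
    by (rule continuous_on_compose2[OF cont]) (use assms in \<open>auto intro!: continuous_intros\<close>)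
  then have "closed {x. w (x, t) \<le> 0}"
    by (intro closed_Collect_le) auto
  then show ?thesis
    using infdist_attains_inf[of "{x. w (x, t) \<le> 0}" x] ex_nonpos[OF assms] that
    by (auto simp: inner_dist_def dist_norm)
qed

text \<open>Along a line through the contact point the profile lies below \<open>\<eta> (d + f s)\<close> when the distance lies
  below \<open>d + f s\<close>. Comparing the expansion of \<open>\<eta>\<close> with the jet gives all spatial information. The
  bound \<open>d\<close> may exceed the distance at the contact point where \<open>\<eta>\<close> is constant.\<close>
lemma jet_along_line:
  fixes u :: "real^'n"
  assumes jet: "lower_jet (moving_profile \<delta> c w) (x0, t0) a b A" and "\<epsilon> > 0" "norm u = 1"
    and dist: "\<forall>\<^sub>F s in F. inner_dist w (x0 + s *\<^sub>R u, t0) \<le> d + f s"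
    and d: "d \<ge> inner_dist w (x0, t0)" "eta \<delta> d = eta \<delta> (inner_dist w (x0, t0))"
    and F: "F \<le> nhds 0" and f: "(f \<longlongrightarrow> 0) F" "\<And>s. (f s)\<^sup>2 = s\<^sup>2" and "\<delta> > 0"
  shows "\<forall>\<^sub>F s in F. s * (b \<bullet> u) + s\<^sup>2 / 2 * (u \<bullet> (A *v u))
    \<le> f s * eta_deriv \<delta> d + s\<^sup>2 / 2 * eta_deriv2 \<delta> d + \<epsilon> * s\<^sup>2"
proof -
  obtain M where M: "\<forall>\<^sub>F q in nhds 0. moving_profile \<delta> c w (x0, t0) + quad b A a M q
      - \<epsilon> / 2 * (norm (fst q))\<^sup>2 \<le> moving_profile \<delta> c w ((x0, t0) + q)"
    using jet[unfolded lower_jet_def, rule_format, of "\<epsilon> / 2"] \<open>\<epsilon> > 0\<close> by auto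
  have "((\<lambda>s. (s *\<^sub>R u, 0)) \<longlongrightarrow> (0 *\<^sub>R u, 0 :: real)) F"
    by (intro tendsto_intros filterlim_mono[OF filterlim_ident _ F]) auto
  then have lim: "((\<lambda>s. (s *\<^sub>R u, 0 :: real)) \<longlongrightarrow> 0) F"
    by (simp add: zero_prod_def)
  have "\<forall>\<^sub>F s in F. moving_profile \<delta> c w (x0, t0) + quad b A a M (s *\<^sub>R u, 0)
      - \<epsilon> / 2 * (norm (fst (s *\<^sub>R u, 0 :: real)))\<^sup>2 \<le> moving_profile \<delta> c w ((x0, t0) + (s *\<^sub>R u, 0))"
    by (rule eventually_compose_filterlim[OF M lim])
  moreover have "\<forall>\<^sub>F s in F. eta \<delta> (d + f s) \<le> eta \<delta> d + f s * eta_deriv \<delta> d + (f s)\<^sup>2 / 2 * eta_deriv2 \<delta> d + \<epsilon> / 2 * (f s)\<^sup>2"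
    by (rule eventually_compose_filterlim[OF eta_taylor[OF \<open>\<delta> > 0\<close>] f(1)]) (use \<open>\<epsilon> > 0\<close> in simp)
  ultimately show ?thesis
    using dist
  proof eventually_elim
    case (elim s)
    have "eta \<delta> (inner_dist w (x0 + s *\<^sub>R u, t0)) \<le> eta \<delta> (d + f s)"
      using eta_mono[OF \<open>\<delta> > 0\<close> elim(3)] .
    moreover have "quad b A a M (s *\<^sub>R u, 0) = s * (b \<bullet> u) + s\<^sup>2 / 2 * (u \<bullet> (A *v u))"
      by (simp add: quad_def matrix_vector_mult_scaleR power2_eq_square)
    ultimately show ?case
      using elim(1,2) \<open>norm u = 1\<close> d(2) unfolding f(2)
      by (simp add: moving_profile_def)
  qed
qed

lemma jet_gradient_le:
  assumes jet: "lower_jet (moving_profile \<delta> c w) (x0, t0) a b A" and "\<delta> > 0"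
  shows "norm b \<le> eta_deriv \<delta> (inner_dist w (x0, t0))"
proof (cases "b = 0")
  case True
  then show ?thesis using eta_deriv_nonneg[OF \<open>\<delta> > 0\<close>] by simp
next
  case False
  define u where "u = b /\<^sub>R norm b"
  define d where "d = inner_dist w (x0, t0)"
  have u: "norm u = 1" "b \<bullet> u = norm b"
    using False by (auto simp: u_def dot_square_norm power2_eq_square)
  have pos: "\<forall>\<^sub>F s::real in at_right 0. s > 0"
    by (simp add: eventually_at_filter)
  have "\<forall>\<^sub>F s in at_right 0. inner_dist w (x0 + s *\<^sub>R u, t0) \<le> d + s"
    using pos
  proof eventually_elim
    case (elim s)
    then show ?case
      using inner_dist_lipschitz[of x0 "s *\<^sub>R u" t0] u(1) by (simp add: d_def)
  qed
  then have "\<forall>\<^sub>F s in at_right 0. s * (b \<bullet> u) + s\<^sup>2 / 2 * (u \<bullet> (A *v u))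
      \<le> s * eta_deriv \<delta> d + s\<^sup>2 / 2 * eta_deriv2 \<delta> d + 1 * s\<^sup>2"
    by (intro jet_along_line[OF jet]) (use u(1) \<open>\<delta> > 0\<close> in \<open>auto simp: d_def at_within_le_nhds intro!: filterlim_mono[OF filterlim_ident]\<close>)
  then have "\<forall>\<^sub>F s in at_right 0. s * (norm b - eta_deriv \<delta> d) \<le> (eta_deriv2 \<delta> d / 2 + 1 - (u \<bullet> (A *v u)) / 2) * s\<^sup>2"
    by eventually_elim (simp add: u(2) algebra_simps)
  then have "norm b - eta_deriv \<delta> d \<le> 0"
    by (rule slope_nonpos_of_quadratic_bound)
  then show ?thesis by (simp add: d_def)
qed

text \<open>On the line through the contact point and its nearest point \<open>z\<close> the distance is at most
  \<open>d + s\<close> on both sides of the contact point. This yields the derivatives in the direction \<open>n\<close>. The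
  gradient has no other component because its length does not exceed its component along \<open>n\<close>.\<close>
lemma jet_normal:
  assumes jet: "lower_jet (moving_profile \<delta> c w) (x0, t0) a b A" and "\<delta> > 0"
    and z: "w (z, t0) \<le> 0" "inner_dist w (x0, t0) = norm (x0 - z)" and "x0 \<noteq> z"
  defines "d \<equiv> inner_dist w (x0, t0)" and "n \<equiv> (x0 - z) /\<^sub>R norm (x0 - z)"
  shows "b = eta_deriv \<delta> d *\<^sub>R n" "n \<bullet> (A *v n) \<le> eta_deriv2 \<delta> d"
proof -
  have n: "norm n = 1"
    using \<open>x0 \<noteq> z\<close> by (simp add: n_def)
  have xz: "x0 - z = d *\<^sub>R n" and "d > 0"
    using \<open>x0 \<noteq> z\<close> by (auto simp: n_def d_def z(2))
  have "\<forall>\<^sub>F s in nhds 0. s > - d"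
    using order_tendstoD(1)[OF filterlim_ident, of "- d" "0::real"] \<open>d > 0\<close> by simp
  then have dist: "\<forall>\<^sub>F s in nhds 0. inner_dist w (x0 + s *\<^sub>R n, t0) \<le> d + s"
  proof eventually_elim
    case (elim s)
    have "x0 + s *\<^sub>R n - z = (d + s) *\<^sub>R n"
      using xz by (simp add: algebra_simps)
    then have "norm (x0 + s *\<^sub>R n - z) = d + s"
      using n elim by simp
    then show ?case
      using inner_dist_le[OF z(1), of "x0 + s *\<^sub>R n"] by simp
  qed
  have "\<forall>\<^sub>F s in nhds 0. s * (b \<bullet> n - eta_deriv \<delta> d) + s\<^sup>2 * ((n \<bullet> (A *v n) - eta_deriv2 \<delta> d) / 2) \<le> \<epsilon> * s\<^sup>2"
    if "\<epsilon> > 0" for \<epsilon>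
  proof -
    have "\<forall>\<^sub>F s in nhds 0. s * (b \<bullet> n) + s\<^sup>2 / 2 * (n \<bullet> (A *v n))
      \<le> s * eta_deriv \<delta> d + s\<^sup>2 / 2 * eta_deriv2 \<delta> d + \<epsilon> * s\<^sup>2"
      by (rule jet_along_line[OF jet that n dist]) (use \<open>\<delta> > 0\<close> in \<open>auto simp: d_def filterlim_ident\<close>)
    then show ?thesis
      by eventually_elim (simp add: field_simps)
  qed
  from quadratic_nonpos[OF this] have bn: "b \<bullet> n = eta_deriv \<delta> d" and nn: "n \<bullet> (A *v n) \<le> eta_deriv2 \<delta> d"
    by auto
  show "n \<bullet> (A *v n) \<le> eta_deriv2 \<delta> d" by (rule nn)
  have "norm b \<le> eta_deriv \<delta> d"
    using jet_gradient_le[OF jet \<open>\<delta> > 0\<close>] by (simp add: d_def)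
  then have "(norm b)\<^sup>2 \<le> (eta_deriv \<delta> d)\<^sup>2"
    by (intro power_mono) auto
  moreover have "(norm (b - eta_deriv \<delta> d *\<^sub>R n))\<^sup>2 = (norm b)\<^sup>2 - (eta_deriv \<delta> d)\<^sup>2"
  proof -
    have "n \<bullet> n = 1" using n by (simp add: dot_square_norm)
    then show ?thesis
      by (simp add: power2_norm_eq_inner inner_diff_left inner_diff_right inner_commute[of n b] bn)
        (simp add: power2_eq_square)
  qed
  ultimately have "(norm (b - eta_deriv \<delta> d *\<^sub>R n))\<^sup>2 \<le> 0" by simp
  then show "b = eta_deriv \<delta> d *\<^sub>R n" by simp
qed

lemma jet_flat:
  assumes jet: "lower_jet (moving_profile \<delta> c w) (x0, t0) a b A" and "\<delta> > 0"
    and flat: "inner_dist w (x0, t0) \<le> \<delta> / 4"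
  shows "(\<Sum>i\<in>UNIV. A $ i $ i) \<le> 0"
proof (rule sum_nonpos)
  fix i :: 'n
  define u :: "real^'n" where "u = axis i 1"
  have e: "eta_deriv \<delta> (\<delta> / 4) = 0" "eta_deriv2 \<delta> (\<delta> / 4) = 0" "eta_deriv \<delta> (inner_dist w (x0, t0)) = 0"
    using flat by (auto simp: eta_deriv_def eta_deriv2_def)
  have "b = 0"
    using jet_gradient_le[OF jet \<open>\<delta> > 0\<close>] e by simp
  have u: "norm u = 1" by (simp add: u_def norm_axis_1)
  have dist: "\<forall>\<^sub>F s in nhds 0. inner_dist w (x0 + s *\<^sub>R u, t0) \<le> \<delta> / 4 + \<bar>s\<bar>"
  proof (rule always_eventually, rule allI)
    fix s
    show "inner_dist w (x0 + s *\<^sub>R u, t0) \<le> \<delta> / 4 + \<bar>s\<bar>"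
      using inner_dist_lipschitz[of x0 "s *\<^sub>R u" t0] u flat by simp
  qed
  have "((\<lambda>s::real. \<bar>s\<bar>) \<longlongrightarrow> \<bar>0\<bar>) (nhds 0)"
    by (intro tendsto_rabs filterlim_ident)
  then have "\<forall>\<^sub>F s in nhds 0. s * (b \<bullet> u) + s\<^sup>2 / 2 * (u \<bullet> (A *v u))
      \<le> \<bar>s\<bar> * eta_deriv \<delta> (\<delta> / 4) + s\<^sup>2 / 2 * eta_deriv2 \<delta> (\<delta> / 4) + \<epsilon> * s\<^sup>2" if "\<epsilon> > 0" for \<epsilon>
    by (intro jet_along_line[OF jet that u dist]) (use flat \<open>\<delta> > 0\<close> in \<open>auto simp: eta_eq_left\<close>)
  then have "\<forall>\<^sub>F s in nhds 0. s * 0 + s\<^sup>2 * ((u \<bullet> (A *v u)) / 2) \<le> \<epsilon> * s\<^sup>2" if "\<epsilon> > 0" for \<epsilon>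
    using that by (simp add: \<open>b = 0\<close> e)
  from quadratic_nonpos(2)[OF this] have "u \<bullet> (A *v u) \<le> 0" by simp
  then show "A $ i $ i \<le> 0"
    by (simp add: u_def inner_axis' matrix_vector_mult_basis column_def)
qed

text \<open>The distance cannot drop abruptly: if it had been larger at the earlier time, a ball in the
  positive set would have survived until \<open>t0\<close> and would contain the nearest point of the
  nonpositive set.\<close>
lemma inner_dist_earlier_le:
  assumes "\<delta> > 0" and flat: "inner_dist w (x0, t0) \<le> \<delta> / 4" and "0 < \<sigma>" "\<sigma> < t0"
  shows "inner_dist w (x0, t0 - \<sigma>) \<le> \<delta> / 4 + 2 * (4 * real CARD('n) + 3) / \<delta> * \<sigma>"
proof -
  define C where "C = 4 * real CARD('n) + 3"
  define R where "R = inner_dist w (x0, t0 - \<sigma>)"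
  have "C > 0" by (simp add: C_def)
  obtain z where z: "w (z, t0) \<le> 0" "inner_dist w (x0, t0) = norm (x0 - z)"
    using inner_dist_attained[of t0 x0] assms by auto
  have "R\<^sup>2 \<le> (\<delta> / 4)\<^sup>2 + C * \<sigma>"
  proof (rule ccontr)
    assume "\<not> R\<^sup>2 \<le> (\<delta> / 4)\<^sup>2 + C * \<sigma>"
    moreover have "(norm (z - x0))\<^sup>2 \<le> (\<delta> / 4)\<^sup>2"
      using z(2) flat by (intro power_mono) (auto simp: norm_minus_commute)
    ultimately have less: "(norm (z - x0))\<^sup>2 + C * (t0 - (t0 - \<sigma>)) < R\<^sup>2" by simp
    have "R \<noteq> 0"
      using less \<open>C > 0\<close> \<open>0 < \<sigma>\<close> by (smt (verit) mult_pos_pos power_zero_numeral zero_le_power2)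
    then have "R > 0"
      using inner_dist_nonneg[of "(x0, t0 - \<sigma>)"] by (simp add: R_def)
    have pos: "w (x, t0 - \<sigma>) > 0" if "norm (x - x0) < R" for x
      using inner_dist_le[of x "t0 - \<sigma>" x0] that by (force simp: R_def norm_minus_commute)
    have "w (z, t0) > 0"
    proof (rule positive_ball_persists[OF super cont, of "t0 - \<sigma>" x0 R])
      show "w (x, t0 - \<sigma>) > 0" if "norm (x - x0) < R" for x
        using pos[OF that] .
    qed (use less assms \<open>R > 0\<close> in \<open>auto simp: C_def\<close>)
    then show False using z(1) by simp
  qed
  also have "\<dots> \<le> (\<delta> / 4 + 2 * C / \<delta> * \<sigma>)\<^sup>2"
    using assms \<open>C > 0\<close> by (simp add: power2_eq_square field_simps)
  finally have "R \<le> \<delta> / 4 + 2 * C / \<delta> * \<sigma>"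
    by (rule power2_le_imp_le) (use assms \<open>C > 0\<close> in simp)
  then show ?thesis by (simp add: R_def C_def)
qed

text \<open>Shortly before \<open>t0\<close> the distance exceeds \<open>\<delta>/4\<close> by at most a multiple of the elapsed time \<open>\<sigma>\<close>.
  Since \<open>\<eta>\<close> leaves its flat part with slope and curvature zero, the profile
  grows backward in time only by \<open>O(\<sigma>\<^sup>2)\<close>, apart from the linear term \<open>c t\<close>.\<close>
lemma jet_flat_time:
  assumes jet: "lower_jet (moving_profile \<delta> c w) (x0, t0) a b A" and "\<delta> > 0" "t0 > 0"
    and flat: "inner_dist w (x0, t0) \<le> \<delta> / 4"
  shows "c \<le> a"
proof -
  define k where "k = 2 * (4 * real CARD('n) + 3) / \<delta>"
  obtain M where M: "\<forall>\<^sub>F q in nhds 0. moving_profile \<delta> c w (x0, t0) + quad b A a M q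
      - 1 * (norm (fst q))\<^sup>2 \<le> moving_profile \<delta> c w ((x0, t0) + q)"
    using jet[unfolded lower_jet_def, rule_format, OF zero_less_one] by auto
  have lim: "((\<lambda>\<sigma>::real. \<sigma>) \<longlongrightarrow> 0) (at_right 0)"
    by simp
  have "((\<lambda>\<sigma>::real. (0 :: real^'n, - \<sigma>)) \<longlongrightarrow> (0, - 0)) (at_right 0)"
    by (intro tendsto_intros lim)
  then have "((\<lambda>\<sigma>::real. (0 :: real^'n, - \<sigma>)) \<longlongrightarrow> 0) (at_right 0)"
    by (simp add: zero_prod_def)
  then have "\<forall>\<^sub>F \<sigma> in at_right 0. moving_profile \<delta> c w (x0, t0) + quad b A a M (0, - \<sigma>)
      - 1 * (norm (fst (0 :: real^'n, - \<sigma>)))\<^sup>2 \<le> moving_profile \<delta> c w ((x0, t0) + (0, - \<sigma>))"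
    by (rule eventually_compose_filterlim[OF M])
  moreover have "\<forall>\<^sub>F \<sigma> in at_right 0. eta \<delta> (\<delta> / 4 + k * \<sigma>) \<le> eta \<delta> (\<delta> / 4) + (k * \<sigma>) * eta_deriv \<delta> (\<delta> / 4)
      + (k * \<sigma>)\<^sup>2 / 2 * eta_deriv2 \<delta> (\<delta> / 4) + 1 * (k * \<sigma>)\<^sup>2"
  proof -
    have "((\<lambda>\<sigma>::real. k * \<sigma>) \<longlongrightarrow> k * 0) (at_right 0)"
      by (intro tendsto_intros lim)
    then have "((\<lambda>\<sigma>::real. k * \<sigma>) \<longlongrightarrow> 0) (at_right 0)" by simp
    then show ?thesis
      by (rule eventually_compose_filterlim[OF eta_taylor[OF \<open>\<delta> > 0\<close> zero_less_one]])
  qed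
  moreover have "\<forall>\<^sub>F \<sigma>::real in at_right 0. \<sigma> > 0"
    by (simp add: eventually_at_filter)
  moreover have "\<forall>\<^sub>F \<sigma>::real in at_right 0. \<sigma> < t0"
    using order_tendstoD(2)[OF lim \<open>t0 > 0\<close>] .
  ultimately have "\<forall>\<^sub>F \<sigma> in at_right 0. \<sigma> * (c - a) \<le> (M + k\<^sup>2) * \<sigma>\<^sup>2"
  proof eventually_elim
    case (elim \<sigma>)
    have "eta \<delta> (inner_dist w (x0, t0 - \<sigma>)) \<le> eta \<delta> (\<delta> / 4 + k * \<sigma>)"
      unfolding k_def by (intro eta_mono inner_dist_earlier_le) (use assms elim in auto)
    moreover have "eta \<delta> (inner_dist w (x0, t0)) = eta \<delta> (\<delta> / 4)"
      using flat by (simp add: eta_eq_left)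
    ultimately show ?case
      using elim(1,2) by (simp add: moving_profile_def quad_def eta_deriv_def eta_deriv2_def power_mult_distrib algebra_simps)
  qed
  then show ?thesis
    using slope_nonpos_of_quadratic_bound by force
qed

text \<open>The jet is moved from the contact point to the nearest point \<open>z\<close>. A point \<open>x\<close> of the nonpositive
  set near \<open>z\<close> bounds the distance at \<open>x + x0 - z\<close> by \<open>d\<close>, so the moved polynomial, after subtracting
  \<open>c\<close> from its time derivative, is nonpositive on the nonpositive set. The curvature
  inequality bounds the trace of \<open>A\<close> without its normal part, and the normal part is at most \<open>\<eta>''\<close>.\<close>
lemma jet_moving_time:
  assumes jet: "lower_jet (moving_profile \<delta> c w) (x0, t0) a b A" and "\<delta> > 0" "t0 > 0"
    and moving: "inner_dist w (x0, t0) > \<delta> / 4"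
  shows "(\<Sum>i\<in>UNIV. A $ i $ i) - eta_deriv2 \<delta> (inner_dist w (x0, t0)) \<le> a - c"
proof -
  define d where "d = inner_dist w (x0, t0)"
  obtain z where z: "w (z, t0) \<le> 0" "inner_dist w (x0, t0) = norm (x0 - z)"
    using inner_dist_attained[of t0 x0] assms by auto
  have "x0 \<noteq> z"
    using z(2) moving \<open>\<delta> > 0\<close> by auto
  define n where "n = (x0 - z) /\<^sub>R norm (x0 - z)"
  note normal = jet_normal[OF jet \<open>\<delta> > 0\<close> z \<open>x0 \<noteq> z\<close>, folded n_def d_def]
  have n: "norm n = 1"
    using \<open>x0 \<noteq> z\<close> by (simp add: n_def)
  have "eta_deriv \<delta> d > 0"
    using eta_deriv_pos[OF \<open>\<delta> > 0\<close> moving] by (simp add: d_def)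
  then have b: "b \<noteq> 0" "b /\<^sub>R norm b = n"
    using n normal(1) by auto
  have "curvature_op n A \<le> a - c"
  proof (rule field_le_epsilon)
    fix e :: real assume "e > 0"
    define \<epsilon> where "\<epsilon> = e / (4 * real CARD('n))"
    have "\<epsilon> > 0"
      using \<open>e > 0\<close> by (simp add: \<epsilon>_def)
    \<comment> \<open>The matrix of a jet need not be symmetric, and the antisymmetric part contributes neither to
      the quadratic form nor to the curvature. The multiple of the identity pays for the error of the jet and for
      strictness, and costs at most \<open>e\<close> in the curvature.\<close>
    define B where "B = (1 / 2) *\<^sub>R (A + transpose A) + (- 4 * \<epsilon>) *\<^sub>R mat 1"
    have sym: "transpose B = B"
      by (auto simp: B_def transpose_def mat_def vec_eq_iff)
    obtain M where M: "\<forall>\<^sub>F q in nhds 0. moving_profile \<delta> c w (x0, t0) + quad b A a M q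
        - \<epsilon> * (norm (fst q))\<^sup>2 \<le> moving_profile \<delta> c w ((x0, t0) + q)"
      using jet[unfolded lower_jet_def, rule_format, OF \<open>\<epsilon> > 0\<close>] by auto
    have quad_B: "quad b B (a - c) (M + \<epsilon>) q
        = quad b A a M q - c * snd q - 2 * \<epsilon> * (norm (fst q))\<^sup>2 - \<epsilon> * (snd q)\<^sup>2" for q
    proof -
      have "fst q \<bullet> (transpose A *v fst q) = fst q \<bullet> (A *v fst q)"
        by (metis dot_lmul_matrix inner_commute transpose_matrix_vector)
      then have "fst q \<bullet> (B *v fst q) = fst q \<bullet> (A *v fst q) - 4 * \<epsilon> * (norm (fst q))\<^sup>2"
        unfolding B_def matrix_vector_mult_add_rdistrib scaled_identity_simps(1)
          scaleR_matrix_vector_assoc[symmetric] inner_add_right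
        by (simp add: inner_add_right power2_norm_eq_inner)
      then show ?thesis
        by (simp add: quad_def algebra_simps)
    qed
    have "((\<lambda>p. p - (z, t0)) \<longlongrightarrow> (z, t0) - (z, t0)) (nhds (z, t0))"
      by (intro tendsto_intros filterlim_ident)
    then have lim: "((\<lambda>p. p - (z, t0)) \<longlongrightarrow> 0) (nhds (z, t0))" by simp
    have "\<forall>\<^sub>F p in nhds (z, t0). moving_profile \<delta> c w (x0, t0) + quad b A a M (p - (z, t0))
        - \<epsilon> * (norm (fst (p - (z, t0))))\<^sup>2 \<le> moving_profile \<delta> c w ((x0, t0) + (p - (z, t0)))"
      by (rule eventually_compose_filterlim[OF M lim])
    then have touch: "\<forall>\<^sub>F p in nhds (z, t0). w p \<le> 0 \<longrightarrow>
      quad b B (a - c) (M + \<epsilon>) (p - (z, t0)) \<le> - \<epsilon> * (norm (p - (z, t0)))\<^sup>2"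
    proof eventually_elim
      case (elim p)
      obtain x t where p: "p = (x, t)" by (cases p)
      show ?case
      proof
        assume "w p \<le> 0"
        then have "inner_dist w (x0 + (x - z), t) \<le> d"
          using inner_dist_le[of x t "x0 + (x - z)"] z(2) by (simp add: p d_def)
        then have "eta \<delta> (inner_dist w (x0 + (x - z), t)) \<le> eta \<delta> d"
          by (rule eta_mono[OF \<open>\<delta> > 0\<close>])
        then have "quad b A a M (p - (z, t0)) \<le> c * (t - t0) + \<epsilon> * (norm (x - z))\<^sup>2"
          using elim by (simp add: p moving_profile_def d_def algebra_simps)
        moreover have "(norm (p - (z, t0)))\<^sup>2 = (norm (x - z))\<^sup>2 + (t - t0)\<^sup>2"
          by (simp add: p norm_Pair)
        ultimately show "quad b B (a - c) (M + \<epsilon>) (p - (z, t0)) \<le> - \<epsilon> * (norm (p - (z, t0)))\<^sup>2"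
          unfolding quad_B by (simp add: p algebra_simps)
      qed
    qed
    have "curvature_op n B \<le> a - c"
      using nonpositive_set_touched_by_quad_noncritical[OF super cont sym \<open>t0 > 0\<close> \<open>\<epsilon> > 0\<close> z(1) touch b(1)]
      by (simp add: b(2))
    moreover have "curvature_op n (transpose A) = curvature_op n A"
      by (simp add: curvature_op_alt transpose_def[of A, THEN arg_cong[where f = "\<lambda>X. X $ _ $ _"]])
        (metis dot_lmul_matrix inner_commute transpose_matrix_vector)
    then have "curvature_op n B = curvature_op n A - 4 * \<epsilon> * (real CARD('n) - 1)"
      unfolding B_def scaled_identity_simps(3-5) using n by (simp add: scaled_identity_simps(3)[of n 1, simplified])
    moreover have "4 * \<epsilon> * (real CARD('n) - 1) \<le> e"
      using \<open>e > 0\<close> by (simp add: \<epsilon>_def field_simps)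
    ultimately show "curvature_op n A \<le> a - c + e" by linarith
  qed
  then show ?thesis
    using normal(2) by (simp add: curvature_op_alt d_def)
qed

lemma profile_jet:
  assumes jet: "lower_jet (moving_profile \<delta> c w) (x0, t0) a b A" and "\<delta> > 0" "t0 > 0"
  defines "d \<equiv> inner_dist w (x0, t0)"
  shows "norm b = eta_deriv \<delta> d" "c - eta_deriv2 \<delta> d \<le> a - (\<Sum>i\<in>UNIV. A $ i $ i)"
proof -
  have "norm b = eta_deriv \<delta> d \<and> c - eta_deriv2 \<delta> d \<le> a - (\<Sum>i\<in>UNIV. A $ i $ i)"
  proof (cases "d \<le> \<delta> / 4")
    case True
    then have e: "eta_deriv \<delta> d = 0" "eta_deriv2 \<delta> d = 0"
      by (auto simp: eta_deriv_def eta_deriv2_def)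
    then show ?thesis
      using jet_gradient_le[OF jet \<open>\<delta> > 0\<close>] jet_flat[OF jet \<open>\<delta> > 0\<close>]
        jet_flat_time[OF jet \<open>\<delta> > 0\<close> \<open>t0 > 0\<close>] True by (auto simp: d_def)
  next
    case False
    obtain z where z: "w (z, t0) \<le> 0" "inner_dist w (x0, t0) = norm (x0 - z)"
      using inner_dist_attained[of t0 x0] \<open>t0 > 0\<close> by auto
    have "x0 \<noteq> z"
      using z(2) False \<open>\<delta> > 0\<close> by (auto simp: d_def)
    then show ?thesis
      using jet_normal(1)[OF jet \<open>\<delta> > 0\<close> z] jet_moving_time[OF jet \<open>\<delta> > 0\<close> \<open>t0 > 0\<close>]
        eta_deriv_nonneg[OF \<open>\<delta> > 0\<close>] False by (auto simp: d_def)
  qed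
  then show "norm b = eta_deriv \<delta> d" "c - eta_deriv2 \<delta> d \<le> a - (\<Sum>i\<in>UNIV. A $ i $ i)"
    by auto
qed

text \<open>A closed ball in the positive set stays in it under small displacements of the centre and of
  time, by compactness.\<close>
lemma inner_dist_greater_near:
  assumes "snd p > 0" "b \<ge> 0" "b < inner_dist w p"
  shows "\<forall>\<^sub>F q in nhds p. b < inner_dist w q"
proof -
  define O' where "O' = {u :: ((real^'n) \<times> real) \<times> (real^'n). snd (fst u) > 0}"
  define W where "W = O' \<inter> (\<lambda>u. w (fst (fst u) + snd u, snd (fst u))) -` {0<..}"
  have "open O'"
    unfolding O'_def by (intro open_Collect_less continuous_intros)
  then have "open W"
    unfolding W_def
    by (intro continuous_open_preimage continuous_on_compose2[OF cont] continuous_intros)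
      (auto simp: O'_def)
  have in_W: "w (fst p + y, snd p) > 0" if "norm y \<le> b" for y
    using inner_dist_le[of "fst p + y" "snd p" "fst p"] that assms(3) by force
  then have "{p} \<times> cball 0 b \<subseteq> W"
    using assms(1) by (auto simp: W_def O'_def)
  then have "\<exists>X. p \<in> X \<and> open X \<and> X \<times> cball 0 b \<subseteq> W"
    by (rule Elementary_Topology.tube_lemma[OF compact_cball \<open>open W\<close>])
  then obtain X where X: "p \<in> X" "open X" "X \<times> cball 0 b \<subseteq> W"
    by (elim exE conjE)
  have "b < inner_dist w q" if "q \<in> X" for q
  proof -
    have "(q, 0) \<in> W"
      using X(3) that assms(2) by auto
    then have "snd q > 0" by (simp add: W_def O'_def)
    then obtain z where z: "w (z, snd q) \<le> 0" "inner_dist w q = norm (fst q - z)"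
      using inner_dist_attained[of "snd q" "fst q"] by auto
    show ?thesis
    proof (rule ccontr)
      assume "\<not> ?thesis"
      then have "(q, z - fst q) \<in> W"
        using X(3) that z(2) by (auto simp: norm_minus_commute)
      then show False
        using z(1) by (simp add: W_def)
    qed
  qed
  then show ?thesis
    unfolding eventually_nhds using X(1,2) by blast
qed

lemma moving_profile_lsc:
  assumes "\<delta> > 0" "snd p > 0" "a < moving_profile \<delta> c w p"
  shows "\<forall>\<^sub>F q in nhds p. a < moving_profile \<delta> c w q"
proof -
  define d where "d = inner_dist w p"
  define e where "e = (moving_profile \<delta> c w p - a) / 2"
  have "e > 0" using assms(3) by (simp add: e_def)
  have "\<forall>\<^sub>F q in nhds p. eta \<delta> (inner_dist w q) > eta \<delta> d - e"
  proof (cases "d = 0")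
    case True
    have "eta \<delta> (inner_dist w q) > eta \<delta> d - e" for q
      using eta_mono[OF \<open>\<delta> > 0\<close> inner_dist_nonneg[of q]] True \<open>e > 0\<close> by simp
    then show ?thesis by simp
  next
    case False
    then have "d > 0" using inner_dist_nonneg[of p] by (simp add: d_def)
    have "isCont (eta \<delta>) d"
      by (rule DERIV_isCont[OF eta_has_derivative[OF \<open>\<delta> > 0\<close>]])
    then have "(eta \<delta> \<longlongrightarrow> eta \<delta> d) (nhds d)"
      by (simp add: isCont_def tendsto_at_iff_tendsto_nhds)
    then have "\<forall>\<^sub>F z in nhds d. eta \<delta> z > eta \<delta> d - e"
      by (rule order_tendstoD) (use \<open>e > 0\<close> in simp)
    then obtain r where r: "r > 0" "\<And>z. \<bar>z - d\<bar> < r \<Longrightarrow> eta \<delta> z > eta \<delta> d - e"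
      unfolding eventually_nhds_metric dist_real_def by blast
    define b where "b = max 0 (d - r / 2)"
    have "eta \<delta> b > eta \<delta> d - e"
      by (rule r(2)) (use r(1) \<open>d > 0\<close> in \<open>auto simp: b_def max_def\<close>)
    moreover have "\<forall>\<^sub>F q in nhds p. b < inner_dist w q"
      by (rule inner_dist_greater_near[OF assms(2)]) (use r(1) \<open>d > 0\<close> in \<open>auto simp: b_def d_def\<close>)
    ultimately show ?thesis
      by (auto elim!: eventually_mono intro: less_le_trans eta_mono[OF \<open>\<delta> > 0\<close>] less_imp_le)
  qed
  moreover have "((\<lambda>q. c * snd q) \<longlongrightarrow> c * snd p) (nhds p)"
    by (intro tendsto_intros filterlim_ident)
  then have "\<forall>\<^sub>F q in nhds p. c * snd q > c * snd p - e"
    by (rule order_tendstoD) (use \<open>e > 0\<close> in simp)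
  ultimately show ?thesis
  proof eventually_elim
    case (elim q)
    have "moving_profile \<delta> c w p - 2 * e = a"
      unfolding e_def by (simp add: field_simps)
    then show ?case
      using elim unfolding moving_profile_def d_def by linarith
  qed
qed

text \<open>Where \<open>w > 0\<close>, the segment to a nearest point of the nonpositive set crosses the front, so the two
  distances agree. Elsewhere both arguments lie in the flat part of \<open>\<eta>\<close>.\<close>
lemma eta_signed_dist:
  assumes "\<delta> > 0" "t \<ge> 0" and front: "front w t \<noteq> {}"
  shows "eta \<delta> (signed_dist w (x, t)) = eta \<delta> (inner_dist w (x, t))"
proof (cases "w (x, t) > 0")
  case False
  then have "inner_dist w (x, t) \<le> 0"
    using inner_dist_le[of x t x] by simp
  moreover have "signed_dist w (x, t) \<le> 0"
    using False infdist_nonneg[of x "front w t"] by (simp add: signed_dist_def)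
  ultimately show ?thesis
    using \<open>\<delta> > 0\<close> by (simp add: eta_eq_left)
next
  case True
  obtain z where z: "w (z, t) \<le> 0" "inner_dist w (x, t) = norm (x - z)"
    using inner_dist_attained[OF \<open>t \<ge> 0\<close>] by blast
  have "continuous_on {0..1} (\<lambda>s. w (x + s *\<^sub>R (z - x), t))"
    by (rule continuous_on_compose2[OF cont]) (use \<open>t \<ge> 0\<close> in \<open>auto intro!: continuous_intros\<close>)
  then obtain s where s: "0 \<le> s" "s \<le> 1" "w (x + s *\<^sub>R (z - x), t) = 0"
    using IVT2'[of "\<lambda>s. w (x + s *\<^sub>R (z - x), t)" 1 0 0] True z(1) by auto
  then have "infdist x (front w t) \<le> dist x (x + s *\<^sub>R (z - x))"
    by (intro infdist_le) (simp add: front_def)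
  also have "\<dots> \<le> norm (x - z)"
    using s by (simp add: dist_norm norm_minus_commute mult_left_le_one_le)
  finally have "infdist x (front w t) \<le> inner_dist w (x, t)"
    by (simp add: z(2))
  moreover have "inner_dist w (x, t) \<le> infdist x (front w t)"
    unfolding inner_dist_def fst_conv snd_conv
    by (rule infdist_mono) (use front in \<open>auto simp: front_def\<close>)
  ultimately show ?thesis
    using True by (simp add: signed_dist_def)
qed

end

section \<open>The control map as a stationary profile\<close>

text \<open>The first two components of the control map are a sine times \<open>cos k\<close> and \<open>sin k\<close>, the third one is the
  cosine of the same angle, which grows with \<open>r\<close> at the rate \<open>\<mu> * control_cos * control_speed\<close>. With the speed
  factor as a third function, the derivatives of all three are polynomials in the three.\<close>
definition control_denom :: "real \<Rightarrow> real \<Rightarrow> real \<Rightarrow> real" where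
  "control_denom \<alpha> \<beta> e = (e + \<beta> / 2)\<^sup>2 + 2 * \<alpha> * e"

definition control_sin :: "real \<Rightarrow> real \<Rightarrow> real \<Rightarrow> real \<Rightarrow> real" where
  "control_sin \<alpha> \<beta> \<mu> s = (exp (2 * \<mu> * s) - \<beta> / 2) / sqrt (control_denom \<alpha> \<beta> (exp (2 * \<mu> * s)))"

definition control_cos :: "real \<Rightarrow> real \<Rightarrow> real \<Rightarrow> real \<Rightarrow> real" where
  "control_cos \<alpha> \<beta> \<mu> s = sqrt (2 * (\<alpha> + \<beta>)) * exp (\<mu> * s) / sqrt (control_denom \<alpha> \<beta> (exp (2 * \<mu> * s)))"

definition control_speed :: "real \<Rightarrow> real \<Rightarrow> real \<Rightarrow> real \<Rightarrow> real" where
  "control_speed \<alpha> \<beta> \<mu> s = (exp (2 * \<mu> * s) + \<beta> / 2) / sqrt (control_denom \<alpha> \<beta> (exp (2 * \<mu> * s)))"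

lemma has_real_derivative_divide_sqrt:
  assumes "(N has_real_derivative N') (at x)" "(D has_real_derivative D') (at x)" "D x > 0"
  shows "((\<lambda>x. N x / sqrt (D x)) has_real_derivative (N' * D x - N x * D' / 2) / sqrt (D x) ^ 3) (at x)"
proof -
  define r where "r = sqrt (D x)"
  have r: "r > 0" "D x = r * r"
    using assms(3) by (auto simp: r_def)
  have "((\<lambda>x. sqrt (D x)) has_real_derivative inverse r / 2 * D') (at x)"
    unfolding r_def by (rule DERIV_chain2[OF DERIV_real_sqrt[OF assms(3)] assms(2)])
  then have "((\<lambda>x. N x / sqrt (D x)) has_real_derivative
      (N' * r - N x * (inverse r / 2 * D')) / (r * r)) (at x)"
    using DERIV_divide[OF assms(1), of "\<lambda>x. sqrt (D x)" "inverse r / 2 * D'"] r(1) by (simp add: r_def)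
  moreover have "(N' * r - N x * (inverse r / 2 * D')) / (r * r) = (N' * D x - N x * D' / 2) / r ^ 3"
    using r(1) unfolding r(2) by (simp add: field_simps power3_eq_cube)
  ultimately show ?thesis
    unfolding r_def by simp
qed

lemma cancel_factor: "(c::real) \<noteq> 0 \<Longrightarrow> a / c * (2 * c * e / x) = 2 * a * e / x"
  by simp

lemma control_denom_pos:
  assumes "\<alpha> + \<beta> > 0" "\<beta> > 0" "e > 0"
  shows "control_denom \<alpha> \<beta> e > 0"
proof -
  have "control_denom \<alpha> \<beta> e = (e - \<beta> / 2)\<^sup>2 + 2 * (\<alpha> + \<beta>) * e"
    by (simp add: control_denom_def power2_eq_square algebra_simps)
  then show ?thesis
    using assms by (simp add: add_nonneg_pos)
qed

lemma C_k_on_2_real_domain: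
  fixes v :: "real \<Rightarrow> 'a::real_normed_vector"
  assumes v: "\<And>s. (v has_vector_derivative v1 s) (at s)"
    and v1: "\<And>s. (v1 has_vector_derivative v2 s) (at s)" and v2: "continuous_on UNIV v2"
  shows "C_k_on 2 UNIV v"
proof -
  have "C_k_on 1 UNIV (\<lambda>s. h *\<^sub>R v1 s)" for h
  proof -
    have "((\<lambda>s. h *\<^sub>R v1 s) has_derivative (\<lambda>k. k *\<^sub>R h *\<^sub>R v2 s)) (at s)" for s
      using has_derivative_scaleR_right[OF v1[of s, unfolded has_vector_derivative_def], of h]
      by (simp add: mult.commute)
    then show ?thesis
      using v2 by (simp add: C_k_on_UNIV_Suc_iff[where f' = "\<lambda>s k. k *\<^sub>R h *\<^sub>R v2 s"]
          continuous_intros del: C_k_on.simps(2))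
  qed
  then show ?thesis
    using C_k_on_UNIV_Suc_iff[of v "\<lambda>s h. h *\<^sub>R v1 s" 1] v
    by (simp add: numeral_2_eq_2 has_vector_derivative_def del: C_k_on.simps)
qed

definition planar :: "real \<Rightarrow> real^3" where "planar k = vector [cos k, sin k, 0]"
definition vertical :: "real^3" where "vertical = vector [0, 0, 1]"

lemma planar_vertical_nth [simp]:
  "planar k $ 1 = cos k" "planar k $ 2 = sin k" "planar k $ 3 = 0"
  "vertical $ 1 = 0" "vertical $ 2 = 0" "vertical $ 3 = 1"
  by (simp_all add: planar_def vertical_def)

lemma norm_planar_vertical: "(norm (a *\<^sub>R planar k + b *\<^sub>R vertical))\<^sup>2 = a\<^sup>2 + b\<^sup>2"
proof -
  have "(norm (a *\<^sub>R planar k + b *\<^sub>R vertical))\<^sup>2 = (a * cos k)\<^sup>2 + (a * sin k)\<^sup>2 + b\<^sup>2"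
    by (simp only: power2_norm_eq_inner inner_vec_def sum_3)
      (simp add: power2_eq_square)
  also have "(a * cos k)\<^sup>2 + (a * sin k)\<^sup>2 = a\<^sup>2 * ((cos k)\<^sup>2 + (sin k)\<^sup>2)"
    by (simp only: power_mult_distrib distrib_left)
  finally show ?thesis by simp
qed

lemma control_map_eq:
  "control_map \<alpha> \<beta> k \<epsilon> s = control_sin \<alpha> \<beta> (sqrt (\<alpha> + \<beta>) / \<epsilon>) s *\<^sub>R planar k
     + control_cos \<alpha> \<beta> (sqrt (\<alpha> + \<beta>) / \<epsilon>) s *\<^sub>R vertical"
  by (simp add: control_map_def control_sin_def control_cos_def control_denom_def Let_def
      vec_eq_iff forall_3)

locale global_control =
  fixes \<alpha> \<beta> \<epsilon> \<mu> :: real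
  assumes pos: "\<alpha> + \<beta> > 0" "\<beta> > 0" and eps_pos: "\<epsilon> > 0"
    and mu: "\<mu> = sqrt (\<alpha> + \<beta>) / \<epsilon>"
begin

abbreviation "Sn \<equiv> control_sin \<alpha> \<beta> \<mu>"
abbreviation "Cs \<equiv> control_cos \<alpha> \<beta> \<mu>"
abbreviation "Sp \<equiv> control_speed \<alpha> \<beta> \<mu>"

lemma control_cos_pos: "Cs s > 0" and control_speed_pos: "Sp s > 0"
  using control_denom_pos[OF pos, of "exp (2 * \<mu> * s)"] pos
  by (auto simp: control_cos_def control_speed_def intro!: divide_pos_pos mult_pos_pos add_pos_pos)

lemma control_cos_sq: "(Cs s)\<^sup>2 = 2 * (\<alpha> + \<beta>) * exp (2 * \<mu> * s) / control_denom \<alpha> \<beta> (exp (2 * \<mu> * s))"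
proof -
  have "(exp (\<mu> * s))\<^sup>2 = exp (2 * \<mu> * s)"
    by (simp add: power2_eq_square exp_add[symmetric])
  then show ?thesis
    using control_denom_pos[OF pos, of "exp (2 * \<mu> * s)"] pos
    by (simp add: control_cos_def power_divide power_mult_distrib)
qed

lemma control_sin_sq: "(Sn s)\<^sup>2 = 1 - (Cs s)\<^sup>2"
  and control_speed_sq: "(Sp s)\<^sup>2 = 1 - \<alpha> / (\<alpha> + \<beta>) * (Cs s)\<^sup>2"
proof -
  define e where "e = exp (2 * \<mu> * s)"
  have D: "control_denom \<alpha> \<beta> e > 0"
    using control_denom_pos[OF pos] by (simp add: e_def)
  have "(Sn s)\<^sup>2 = (e - \<beta> / 2)\<^sup>2 / control_denom \<alpha> \<beta> e"
    using D by (simp add: control_sin_def e_def power_divide)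
  also have "(e - \<beta> / 2)\<^sup>2 = control_denom \<alpha> \<beta> e - 2 * (\<alpha> + \<beta>) * e"
    by (simp add: control_denom_def power2_eq_square algebra_simps)
  finally show "(Sn s)\<^sup>2 = 1 - (Cs s)\<^sup>2"
    using D by (simp add: control_cos_sq e_def[symmetric] diff_divide_distrib)
  have "(Sp s)\<^sup>2 = (e + \<beta> / 2)\<^sup>2 / control_denom \<alpha> \<beta> e"
    using D by (simp add: control_speed_def e_def power_divide)
  also have "(e + \<beta> / 2)\<^sup>2 = control_denom \<alpha> \<beta> e - 2 * \<alpha> * e"
    by (simp add: control_denom_def)
  finally have "(Sp s)\<^sup>2 = 1 - 2 * \<alpha> * e / control_denom \<alpha> \<beta> e"
    using D by (simp add: diff_divide_distrib)
  moreover have "\<alpha> / (\<alpha> + \<beta>) * (2 * (\<alpha> + \<beta>) * e / X) = 2 * \<alpha> * e / X" for X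
    by (rule cancel_factor) (use pos in simp)
  ultimately show "(Sp s)\<^sup>2 = 1 - \<alpha> / (\<alpha> + \<beta>) * (Cs s)\<^sup>2"
    unfolding control_cos_sq e_def[symmetric] by simp
qed

text \<open>The three functions solve a closed polynomial system, which makes higher derivatives
  cheap. After the quotient rule each equation is an identity between polynomials in \<open>exp (2 \<mu> s)\<close>,
  up to the factor \<open>exp (\<mu> s)\<close> in the cosine.\<close>
lemma control_derivatives:
  shows control_sin_deriv: "(Sn has_real_derivative \<mu> * (Cs s)\<^sup>2 * Sp s) (at s)"
    and control_cos_deriv: "(Cs has_real_derivative - \<mu> * Sn s * Cs s * Sp s) (at s)"
    and control_speed_deriv: "(Sp has_real_derivative \<mu> * (\<alpha> / (\<alpha> + \<beta>)) * (Cs s)\<^sup>2 * Sn s) (at s)"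
proof -
  define D where "D s = control_denom \<alpha> \<beta> (exp (2 * \<mu> * s))" for s
  define e where "e = exp (2 * \<mu> * s)"
  define c where "c = sqrt (2 * (\<alpha> + \<beta>))"
  have D: "D s > 0" "D s = (e + \<beta> / 2)\<^sup>2 + 2 * \<alpha> * e"
    using control_denom_pos[OF pos] by (auto simp: D_def control_denom_def e_def)
  have dD: "(D has_real_derivative 2 * \<mu> * e * (2 * (e + \<beta> / 2) + 2 * \<alpha>)) (at s)"
    unfolding D_def[abs_def] control_denom_def e_def
    by (rule derivative_eq_intros refl)+ (simp add: algebra_simps)
  have Cs2: "(Cs s)\<^sup>2 = 2 * (\<alpha> + \<beta>) * e / (sqrt (D s))\<^sup>2"
    using D(1) by (simp add: control_cos_sq e_def[symmetric] D_def)
  have Sn: "Sn s = (e - \<beta> / 2) / sqrt (D s)" and Sp: "Sp s = (e + \<beta> / 2) / sqrt (D s)"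
    and Cs: "Cs s = c * exp (\<mu> * s) / sqrt (D s)"
    by (simp_all add: control_sin_def control_speed_def control_cos_def e_def D_def c_def)
  have SnF: "Sn = (\<lambda>s. (exp (2 * \<mu> * s) - \<beta> / 2) / sqrt (D s))"
    and SpF: "Sp = (\<lambda>s. (exp (2 * \<mu> * s) + \<beta> / 2) / sqrt (D s))"
    and CsF: "Cs = (\<lambda>s. c * exp (\<mu> * s) / sqrt (D s))"
    by (simp_all add: fun_eq_iff control_sin_def control_speed_def control_cos_def D_def c_def)
  have "((\<lambda>s. exp (2 * \<mu> * s) - \<beta> / 2) has_real_derivative 2 * \<mu> * e) (at s)"
    "((\<lambda>s. exp (2 * \<mu> * s) + \<beta> / 2) has_real_derivative 2 * \<mu> * e) (at s)"
    "((\<lambda>s. c * exp (\<mu> * s)) has_real_derivative \<mu> * (c * exp (\<mu> * s))) (at s)"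
    unfolding e_def by (rule derivative_eq_intros refl | simp)+
  note q = this[THEN has_real_derivative_divide_sqrt[OF _ dD D(1)], folded e_def]
  have "2 * \<mu> * e * D s - (e - \<beta> / 2) * (2 * \<mu> * e * (2 * (e + \<beta> / 2) + 2 * \<alpha>)) / 2
      = \<mu> * (2 * (\<alpha> + \<beta>) * e) * (e + \<beta> / 2)"
    unfolding D(2) by (simp add: power2_eq_square algebra_simps) (simp add: field_simps)
  then have "(2 * \<mu> * e * D s - (e - \<beta> / 2) * (2 * \<mu> * e * (2 * (e + \<beta> / 2) + 2 * \<alpha>)) / 2) / sqrt (D s) ^ 3
      = \<mu> * (Cs s)\<^sup>2 * Sp s"
    unfolding Cs2 Sp by (simp add: power2_eq_square power3_eq_cube)
  then show "(Sn has_real_derivative \<mu> * (Cs s)\<^sup>2 * Sp s) (at s)"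
    by (rule q(1)[THEN DERIV_cong, folded SnF])
  have "2 * \<mu> * e * D s - (e + \<beta> / 2) * (2 * \<mu> * e * (2 * (e + \<beta> / 2) + 2 * \<alpha>)) / 2
      = \<mu> * (2 * \<alpha> * e) * (e - \<beta> / 2)"
    unfolding D(2) by (simp add: power2_eq_square algebra_simps)
  moreover have "\<alpha> / (\<alpha> + \<beta>) * (Cs s)\<^sup>2 = 2 * \<alpha> * e / (sqrt (D s))\<^sup>2"
    unfolding Cs2 by (rule cancel_factor) (use pos in simp)
  ultimately have "(2 * \<mu> * e * D s - (e + \<beta> / 2) * (2 * \<mu> * e * (2 * (e + \<beta> / 2) + 2 * \<alpha>)) / 2) / sqrt (D s) ^ 3
      = \<mu> * (\<alpha> / (\<alpha> + \<beta>) * (Cs s)\<^sup>2) * Sn s"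
    unfolding Sn by (simp add: power2_eq_square power3_eq_cube)
  then show "(Sp has_real_derivative \<mu> * (\<alpha> / (\<alpha> + \<beta>)) * (Cs s)\<^sup>2 * Sn s) (at s)"
    by (intro q(2)[THEN DERIV_cong, folded SpF]) (simp only: mult.assoc)
  have "\<mu> * (c * exp (\<mu> * s)) * D s - c * exp (\<mu> * s) * (2 * \<mu> * e * (2 * (e + \<beta> / 2) + 2 * \<alpha>)) / 2
      = - \<mu> * (e - \<beta> / 2) * (c * exp (\<mu> * s)) * (e + \<beta> / 2)"
    unfolding D(2) by (simp add: power2_eq_square algebra_simps)
  then have "(\<mu> * (c * exp (\<mu> * s)) * D s - c * exp (\<mu> * s) * (2 * \<mu> * e * (2 * (e + \<beta> / 2) + 2 * \<alpha>)) / 2)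
      / sqrt (D s) ^ 3 = - \<mu> * Sn s * Cs s * Sp s"
    unfolding Sn Sp Cs by (simp add: power2_eq_square power3_eq_cube)
  then show "(Cs has_real_derivative - \<mu> * Sn s * Cs s * Sp s) (at s)"
    by (rule q(3)[THEN DERIV_cong, folded CsF])
qed

abbreviation "\<gamma> \<equiv> \<alpha> / (\<alpha> + \<beta>)"

lemma has_vector_derivative_planar_vertical:
  assumes "(f has_real_derivative f') (at s)" "(g has_real_derivative g') (at s)"
  shows "((\<lambda>s. f s *\<^sub>R planar k + g s *\<^sub>R vertical) has_vector_derivative
    (f' *\<^sub>R planar k + g' *\<^sub>R vertical)) (at s)"
  using has_vector_derivative_add[OF has_vector_derivative_scaleR[OF assms(1) has_vector_derivative_const]
      has_vector_derivative_scaleR[OF assms(2) has_vector_derivative_const], of "planar k" vertical]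
  by simp

lemma control_map_derivs:
  shows d1_control: "d1 (control_map \<alpha> \<beta> k \<epsilon>) s
      = (\<mu> * (Cs s)\<^sup>2 * Sp s) *\<^sub>R planar k + (- \<mu> * Sn s * Cs s * Sp s) *\<^sub>R vertical" (is "_ = ?v1 s")
    and d2_control: "d2 (control_map \<alpha> \<beta> k \<epsilon>) s
      = (\<mu>\<^sup>2 * (\<gamma> * Cs s ^ 4 * Sn s - 2 * Sn s * (Cs s)\<^sup>2 * (Sp s)\<^sup>2)) *\<^sub>R planar k
        + (- \<mu>\<^sup>2 * (Cs s ^ 3 * (Sp s)\<^sup>2 - (Sn s)\<^sup>2 * Cs s * (Sp s)\<^sup>2 + \<gamma> * (Sn s)\<^sup>2 * Cs s ^ 3)) *\<^sub>R vertical"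
      (is "_ = ?v2 s")
    and C2_control: "C_k_on 2 UNIV (control_map \<alpha> \<beta> k \<epsilon>)"
proof -
  note d = control_sin_deriv control_cos_deriv control_speed_deriv
  have v: "(control_map \<alpha> \<beta> k \<epsilon> has_vector_derivative ?v1 s) (at s)" for s
    unfolding control_map_eq[abs_def] mu[symmetric]
    by (intro has_vector_derivative_planar_vertical d)
  then have "d1 (control_map \<alpha> \<beta> k \<epsilon>) s = ?v1 s" for s
    by (simp add: d1_def vector_derivative_at)
  then have d1: "d1 (control_map \<alpha> \<beta> k \<epsilon>) = ?v1"
    by blast
  then show "d1 (control_map \<alpha> \<beta> k \<epsilon>) s = ?v1 s"
    by simp
  have v1: "(?v1 has_vector_derivative ?v2 s) (at s)" for s
  proof (rule has_vector_derivative_planar_vertical)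
    show "((\<lambda>s. \<mu> * (Cs s)\<^sup>2 * Sp s) has_real_derivative
        \<mu>\<^sup>2 * (\<gamma> * Cs s ^ 4 * Sn s - 2 * Sn s * (Cs s)\<^sup>2 * (Sp s)\<^sup>2)) (at s)"
      by (rule derivative_eq_intros d refl)+ (simp add: power2_eq_square eval_nat_numeral algebra_simps)
    show "((\<lambda>s. - \<mu> * Sn s * Cs s * Sp s) has_real_derivative
        - \<mu>\<^sup>2 * (Cs s ^ 3 * (Sp s)\<^sup>2 - (Sn s)\<^sup>2 * Cs s * (Sp s)\<^sup>2 + \<gamma> * (Sn s)\<^sup>2 * Cs s ^ 3)) (at s)"
      by (rule derivative_eq_intros d refl)+ (simp add: power2_eq_square eval_nat_numeral algebra_simps)
  qed
  then show "d2 (control_map \<alpha> \<beta> k \<epsilon>) s = ?v2 s"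
    unfolding d2_def d1 by (simp add: vector_derivative_at)
  have "continuous_on UNIV Sn" "continuous_on UNIV Cs" "continuous_on UNIV Sp"
    by (intro continuous_at_imp_continuous_on ballI, rule DERIV_isCont, rule d)+
  then have "continuous_on UNIV ?v2"
    by (intro continuous_intros)
  then show "C_k_on 2 UNIV (control_map \<alpha> \<beta> k \<epsilon>)"
    by (rule C_k_on_2_real_domain[OF v v1])
qed

lemma control_map_sphere: "control_map \<alpha> \<beta> k \<epsilon> s \<in> sphere 0 1"
proof -
  have "(norm (control_map \<alpha> \<beta> k \<epsilon> s))\<^sup>2 = 1"
    by (simp add: control_map_eq mu[symmetric] norm_planar_vertical control_sin_sq)
  then show ?thesis
    by (simp add: power2_eq_1_iff) (use norm_ge_zero[of "control_map \<alpha> \<beta> k \<epsilon> s"] in linarith)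
qed

text \<open>The first two components have a constant ratio, so both coefficients of the first scalar equation
  vanish.\<close>
lemma control_map_meridian:
  shows "control_map \<alpha> \<beta> k \<epsilon> s $ 2 * d1 (control_map \<alpha> \<beta> k \<epsilon>) s $ 1
      - control_map \<alpha> \<beta> k \<epsilon> s $ 1 * d1 (control_map \<alpha> \<beta> k \<epsilon>) s $ 2 = 0"
    and "control_map \<alpha> \<beta> k \<epsilon> s $ 2 * d2 (control_map \<alpha> \<beta> k \<epsilon>) s $ 1
      - control_map \<alpha> \<beta> k \<epsilon> s $ 1 * d2 (control_map \<alpha> \<beta> k \<epsilon>) s $ 2 = 0"
  by (simp_all add: control_map_eq d1_control d2_control)

text \<open>The product of the second and the third quantity is the source term, and it equals the first
  quantity: the third component solves the stationary one-dimensional equation.\<close>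
lemma control_map_stationary:
  fixes s k :: real
  defines "y \<equiv> control_map \<alpha> \<beta> k \<epsilon> s" and "y1 \<equiv> d1 (control_map \<alpha> \<beta> k \<epsilon>) s"
    and "y2 \<equiv> d2 (control_map \<alpha> \<beta> k \<epsilon>) s"
  shows "y2 $ 3 + (norm y1)\<^sup>2 * y $ 3 = \<mu>\<^sup>2 * (Sn s)\<^sup>2 * Cs s * (1 - 2 * \<gamma> * (Cs s)\<^sup>2)"
    and "1 / \<epsilon>\<^sup>2 * (\<alpha> + \<beta> - 2 * \<alpha> * (y $ 3)\<^sup>2) = \<mu>\<^sup>2 * (1 - 2 * \<gamma> * (Cs s)\<^sup>2)"
    and "y $ 3 * (1 - (y $ 3)\<^sup>2) = (Sn s)\<^sup>2 * Cs s"
    and "y1 $ 3 = - \<mu> * Sn s * Cs s * Sp s"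
proof -
  have "(norm y1)\<^sup>2 = \<mu>\<^sup>2 * (Cs s)\<^sup>2 * (Sp s)\<^sup>2 * ((Cs s)\<^sup>2 + (Sn s)\<^sup>2)"
    unfolding y1_def d1_control norm_planar_vertical
    by (simp add: power2_eq_square algebra_simps)
  then have n: "(norm y1)\<^sup>2 = \<mu>\<^sup>2 * (Cs s)\<^sup>2 * (Sp s)\<^sup>2"
    by (simp add: control_sin_sq)
  have "y2 $ 3 + (norm y1)\<^sup>2 * y $ 3 = \<mu>\<^sup>2 * (Sn s)\<^sup>2 * Cs s * ((Sp s)\<^sup>2 - \<gamma> * (Cs s)\<^sup>2)"
    unfolding n
    by (simp add: y2_def y_def d2_control control_map_eq mu[symmetric]
        power2_eq_square power3_eq_cube algebra_simps)
  then show "y2 $ 3 + (norm y1)\<^sup>2 * y $ 3 = \<mu>\<^sup>2 * (Sn s)\<^sup>2 * Cs s * (1 - 2 * \<gamma> * (Cs s)\<^sup>2)"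
    by (simp add: control_speed_sq)
  have musq: "\<mu>\<^sup>2 = 1 / \<epsilon>\<^sup>2 * (\<alpha> + \<beta>)"
    using pos by (simp add: mu power_divide)
  have y3: "y $ 3 = Cs s"
    by (simp add: y_def control_map_eq mu[symmetric])
  have "(\<alpha> + \<beta>) * \<gamma> = \<alpha>"
    using pos by simp
  moreover have "a * (1 - 2 * g * x) = a - 2 * (a * g) * x" for a g x :: real
    by (simp add: algebra_simps)
  ultimately have "(\<alpha> + \<beta>) * (1 - 2 * \<gamma> * (Cs s)\<^sup>2) = \<alpha> + \<beta> - 2 * \<alpha> * (Cs s)\<^sup>2"
    by metis
  then show "1 / \<epsilon>\<^sup>2 * (\<alpha> + \<beta> - 2 * \<alpha> * (y $ 3)\<^sup>2) = \<mu>\<^sup>2 * (1 - 2 * \<gamma> * (Cs s)\<^sup>2)"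
    unfolding musq y3 mult.assoc[of "1 / \<epsilon>\<^sup>2"] by simp
  show "y $ 3 * (1 - (y $ 3)\<^sup>2) = (Sn s)\<^sup>2 * Cs s"
    by (simp add: y_def control_map_eq mu[symmetric] control_sin_sq)
  show "y1 $ 3 = - \<mu> * Sn s * Cs s * Sp s"
    by (simp add: y1_def d1_control)
qed

text \<open>By stationarity the quotients by \<open>v\<^sub>3'\<close> of the coefficient of \<open>N\<close> and of the source term agree, which
  leaves a multiple of \<open>N - 1\<close>. Where \<open>v\<^sub>3' = 0\<close>, the sine vanishes, and with it both terms.\<close>
lemma E2_of_profile_inequality:
  fixes N R k s :: real
  defines "y \<equiv> control_map \<alpha> \<beta> k \<epsilon> s" and "y1 \<equiv> d1 (control_map \<alpha> \<beta> k \<epsilon>) s"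
    and "y2 \<equiv> d2 (control_map \<alpha> \<beta> k \<epsilon>) s"
  assumes R: "- \<mu> * Sn s * (1 - 2 * \<gamma> * (Cs s)\<^sup>2) / Sp s * (N - 1) \<le> R"
  shows "if y1 $ 3 = 0
        then (y2$3 + (norm y1)\<^sup>2 * y$3) * N - 1 / \<epsilon>\<^sup>2 * y$3 * (1 - (y$3)\<^sup>2) * (\<alpha> + \<beta> - 2 * \<alpha> * (y$3)\<^sup>2) = 0
        else R \<ge> (y2$3 + (norm y1)\<^sup>2 * y$3) / y1$3 * N
                 - (\<alpha> + \<beta> - 2 * \<alpha> * (y$3)\<^sup>2) / \<epsilon>\<^sup>2 * (y$3 * (1 - (y$3)\<^sup>2) / y1$3)"
proof -
  note st = control_map_stationary[of k s, folded y_def y1_def y2_def]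
  define B where "B = 1 - 2 * \<gamma> * (Cs s)\<^sup>2"
  have "\<mu> > 0" using pos eps_pos by (simp add: mu)
  have src: "1 / \<epsilon>\<^sup>2 * y$3 * (1 - (y$3)\<^sup>2) * (\<alpha> + \<beta> - 2 * \<alpha> * (y$3)\<^sup>2) = \<mu>\<^sup>2 * (Sn s)\<^sup>2 * Cs s * B"
  proof -
    have "1 / \<epsilon>\<^sup>2 * y$3 * (1 - (y$3)\<^sup>2) * (\<alpha> + \<beta> - 2 * \<alpha> * (y$3)\<^sup>2)
        = (1 / \<epsilon>\<^sup>2 * (\<alpha> + \<beta> - 2 * \<alpha> * (y$3)\<^sup>2)) * (y$3 * (1 - (y$3)\<^sup>2))"
      by (simp only: mult_ac)
    then show ?thesis
      unfolding st(2,3) B_def by (simp only: mult_ac)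
  qed
  have src': "(\<alpha> + \<beta> - 2 * \<alpha> * (y$3)\<^sup>2) / \<epsilon>\<^sup>2 = \<mu>\<^sup>2 * B"
    using st(2) by (simp add: B_def)
  show ?thesis
  proof (cases "Sn s = 0")
    case True
    then show ?thesis
      unfolding src st(1) st(4) by simp
  next
    case False
    then have ne: "- \<mu> * Sn s * Cs s * Sp s \<noteq> 0"
      using \<open>\<mu> > 0\<close> control_cos_pos[of s] control_speed_pos[of s] by simp
    have "\<mu>\<^sup>2 * (Sn s)\<^sup>2 * Cs s * B / (- \<mu> * Sn s * Cs s * Sp s) = - \<mu> * Sn s * B / Sp s"
      "(Sn s)\<^sup>2 * Cs s / (- \<mu> * Sn s * Cs s * Sp s) = - Sn s / (\<mu> * Sp s)"
      using ne by (simp_all add: field_simps power2_eq_square)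
    then have "\<mu>\<^sup>2 * (Sn s)\<^sup>2 * Cs s * B / (- \<mu> * Sn s * Cs s * Sp s) * N
        - \<mu>\<^sup>2 * B * ((Sn s)\<^sup>2 * Cs s / (- \<mu> * Sn s * Cs s * Sp s)) = - \<mu> * Sn s * B / Sp s * (N - 1)"
      using ne by (simp add: field_simps power2_eq_square)
    then show ?thesis
      unfolding st(1,3,4) src' B_def[symmetric] if_not_P[OF ne] using R B_def by simp
  qed
qed

lemma control_coefficient:
  defines "e s \<equiv> exp (2 * \<mu> * s)"
  shows "- Sn s * (1 - 2 * \<gamma> * (Cs s)\<^sup>2) / Sp s
    = (\<beta> / 2 - e s) / (\<beta> / 2 + e s) * (1 - 4 * \<alpha> * e s / control_denom \<alpha> \<beta> (e s))"
proof -
  have D: "sqrt (control_denom \<alpha> \<beta> (e s)) > 0"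
    using control_denom_pos[OF pos] by (simp add: e_def)
  have "\<gamma> * (Cs s)\<^sup>2 = 2 * \<alpha> * e s / control_denom \<alpha> \<beta> (e s)"
    unfolding control_cos_sq e_def by (rule cancel_factor) (use pos in simp)
  then have "2 * \<gamma> * (Cs s)\<^sup>2 = 4 * \<alpha> * e s / control_denom \<alpha> \<beta> (e s)"
    by simp
  moreover have "- Sn s / Sp s = (\<beta> / 2 - e s) / (\<beta> / 2 + e s)"
    using D by (simp add: control_sin_def control_speed_def e_def[symmetric] minus_divide_left add.commute)
  ultimately show ?thesis
    by (metis (no_types) times_divide_eq_left)
qed

end

text \<open>The coefficient in terms of \<open>e = exp (2 \<mu> s)\<close> does not depend on \<open>\<mu>\<close>, so one threshold \<open>s0\<close> serves all
  small \<open>\<epsilon>\<close>.\<close>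
lemma control_coefficient_far:
  assumes "\<beta> > 0"
  obtains s0 :: real where "s0 > 0"
    "\<And>e. 0 < e \<Longrightarrow> e < s0 \<Longrightarrow>
      1 / 2 \<le> (\<beta> / 2 - e) / (\<beta> / 2 + e) * (1 - 4 * \<alpha> * e / control_denom \<alpha> \<beta> e)"
proof -
  let ?f = "\<lambda>e. (\<beta> / 2 - e) / (\<beta> / 2 + e) * (1 - 4 * \<alpha> * e / control_denom \<alpha> \<beta> e)"
  have "(?f \<longlongrightarrow> 1) (at_right 0)"
    unfolding control_denom_def using assms
    by (auto intro!: tendsto_eq_intros)
  then have "\<forall>\<^sub>F e in at_right 0. ?f e > 1 / 2"
    by (rule order_tendstoD) simp
  then show ?thesis
    using that unfolding eventually_at_right_field by (metis less_imp_le)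
qed

section \<open>The supersolution\<close>

lemma front_nonempty_before_extinction:
  assumes "0 < t" "t < extinction_time w"
  shows "front w t \<noteq> {}"
proof
  assume "front w t = {}"
  then have "extinction_time w \<le> t"
    unfolding extinction_time_def using assms(1) by (intro cInf_lower) (auto intro!: bdd_belowI[of _ 0])
  then show False using assms(2) by simp
qed

text \<open>The constant value of \<open>w\<close> far away is read off at time zero, where the initial function is negative
  outside the bounded domain.\<close>
lemma mcf_solution_negative_far_away:
  fixes \<Omega> :: "(real^'n) set"
  assumes "bounded_C3_domain \<Omega>" "initial_function \<Omega> h" "mcf_weak_solution h w"
  obtains R where "R \<ge> 0" "\<And>x t. t \<ge> 0 \<Longrightarrow> norm x \<ge> R \<Longrightarrow> w (x, t) < 0"
proof -
  obtain R c where R: "\<And>x t. t \<ge> 0 \<Longrightarrow> norm x + t \<ge> R \<Longrightarrow> w (x, t) = c"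
    using assms(3) unfolding mcf_weak_solution_def by blast
  have "bounded (closure \<Omega>)"
    using assms(1) by (simp add: bounded_C3_domain_def bounded_closure)
  then obtain B where B: "\<And>x. x \<in> closure \<Omega> \<Longrightarrow> norm x \<le> B"
    unfolding bounded_iff by blast
  obtain x :: "real^'n" where x: "norm x = max \<bar>R\<bar> \<bar>B\<bar> + 1"
    using vector_choose_size[of "max \<bar>R\<bar> \<bar>B\<bar> + 1"] by auto
  have "x \<notin> closure \<Omega>"
    using B[of x] x by auto
  then have "h x < 0"
    using assms(2) by (auto simp: initial_function_def)
  moreover have "w (x, 0) = h x"
    using assms(3) by (auto simp: mcf_weak_solution_def)
  moreover have "w (x, 0) = c"
    by (rule R) (use x in auto)
  ultimately have "c < 0" by simp
  show ?thesis
  proof (rule that[of "\<bar>R\<bar>"])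
    show "w (x, t) < 0" if "t \<ge> 0" "norm x \<ge> \<bar>R\<bar>" for x t
      using R[of t x] that \<open>c < 0\<close> by auto
  qed simp
qed

theorem theorem8p1:
  fixes \<alpha> \<beta> k \<delta> :: real
    and \<Omega> :: "(real^'n) set"
    and h :: "real^'n \<Rightarrow> real"
    and w :: "(real^'n) \<times> real \<Rightarrow> real"
  assumes "\<alpha> + \<beta> > 0" and "\<beta> > 0"
    and "bounded_C3_domain \<Omega>"
    and "initial_function \<Omega> h"
    and "mcf_weak_solution h w"
    and "0 < \<delta>" and "\<delta> < 2 * sqrt (6 * extinction_time w)"
  shows "\<exists>\<epsilon>0>0. \<forall>\<epsilon>. 0 < \<epsilon> \<and> \<epsilon> < \<epsilon>0 \<longrightarrow>
    LL_viscosity_supersolution \<alpha> \<beta> \<epsilon> (extinction_time w) (control_map \<alpha> \<beta> k \<epsilon>)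
      (\<lambda>(x, t). eta \<delta> (signed_dist w (x, t)) + \<delta> / (4 * extinction_time w) * t)
      (\<lambda>(x, t). control_map \<alpha> \<beta> k \<epsilon>
        (eta \<delta> (signed_dist w (x, t)) + \<delta> / (4 * extinction_time w) * t))"
proof -
  define T where "T = extinction_time w"
  define c where "c = \<delta> / (4 * T)"
  define r where "r = (\<lambda>(x, t). eta \<delta> (signed_dist w (x, t)) + c * t)"
  have "0 < 2 * sqrt (6 * T)"
    using assms(6,7) unfolding T_def by linarith
  then have "T > 0" by simp
  then have "c > 0" and cT: "c * T = \<delta> / 4"
    using \<open>0 < \<delta>\<close> by (auto simp: c_def)
  obtain R where R: "R \<ge> 0" "\<And>x t. t \<ge> 0 \<Longrightarrow> norm x \<ge> R \<Longrightarrow> w (x, t) < 0"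
    using mcf_solution_negative_far_away[OF assms(3-5)] by blast
  obtain z0 :: "real^'n" where z0: "norm z0 = R"
    using vector_choose_size[OF \<open>R \<ge> 0\<close>] by auto
  interpret level_set_supersolution w
  proof
    show "mcf_weak_supersolution w" "continuous_on (UNIV \<times> {0..}) w"
      using assms(5) by (auto simp: mcf_weak_solution_def)
    show "\<exists>x. w (x, t) \<le> 0" if "t \<ge> 0" for t
      using R(2)[OF that, of z0] z0 by (auto intro: less_imp_le)
  qed
  have r_eq: "r p = moving_profile \<delta> c w p" if "snd p \<in> {0<..<T}" for p
    using eta_signed_dist[OF \<open>0 < \<delta>\<close>, of "snd p" "fst p"] front_nonempty_before_extinction[of "snd p" w] that
    by (cases p) (auto simp: r_def moving_profile_def T_def)
  have near: "\<forall>\<^sub>F q in nhds p. snd q \<in> {0<..<T}" if "snd p \<in> {0<..<T}" for p :: "(real^'n) \<times> real"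
    using topological_tendstoD[OF tendsto_snd[where f = "\<lambda>q. q", OF filterlim_ident] open_greaterThanLessThan that] .
  have inner_dist_bound: "inner_dist w (x, t) \<le> 2 * R" if "t \<ge> 0" for x t
  proof (cases "norm x \<ge> R")
    case True
    then show ?thesis
      using inner_dist_le[of x t x] R that by (auto simp: less_imp_le)
  next
    case False
    then show ?thesis
      using inner_dist_le[of z0 t x] R(2)[OF that, of z0] norm_triangle_ineq4[of x z0] z0 by simp
  qed
  have bdd: "bounded (r ` (UNIV \<times> {0<..<T}))"
  proof -
    have "\<bar>r p\<bar> \<le> 5 / 8 * \<delta> + \<bar>eta \<delta> (2 * R)\<bar> + \<delta> / 4" if p: "p \<in> UNIV \<times> {0<..<T}" for p
    proof -
      obtain x t where xt: "p = (x, t)" "0 < t" "t < T"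
        using p by (cases p) auto
      have "- 5 / 8 * \<delta> \<le> eta \<delta> (inner_dist w p)"
        using eta_mono[OF \<open>0 < \<delta>\<close> inner_dist_nonneg[of p]] eta_eq_left[of 0 \<delta>] \<open>0 < \<delta>\<close> by simp
      moreover have "eta \<delta> (inner_dist w p) \<le> eta \<delta> (2 * R)"
        using inner_dist_bound[of t x] xt by (intro eta_mono \<open>0 < \<delta>\<close>) auto
      moreover have "0 \<le> c * t" "c * t \<le> \<delta> / 4"
        using xt \<open>c > 0\<close> cT by (auto simp flip: cT)
      ultimately show ?thesis
        using r_eq[of p] xt by (simp add: moving_profile_def)
    qed
    then show ?thesis
      unfolding bounded_iff by (intro exI[of _ "5 / 8 * \<delta> + \<bar>eta \<delta> (2 * R)\<bar> + \<delta> / 4"]) auto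
  qed
  have lsc: "lower_semicontinuous_on (UNIV \<times> {0<..<T}) r"
    unfolding lower_semicontinuous_on_def
  proof (intro ballI allI impI)
    fix p a assume p: "p \<in> UNIV \<times> {0<..<T}" and "a < r p"
    then have p': "snd p \<in> {0<..<T}" by auto
    then have "\<forall>\<^sub>F q in nhds p. a < moving_profile \<delta> c w q"
      using \<open>a < r p\<close> r_eq[of p] by (intro moving_profile_lsc \<open>0 < \<delta>\<close>) auto
    with near[OF p'] have "\<forall>\<^sub>F q in nhds p. a < r q"
      by eventually_elim (simp add: r_eq)
    then show "\<forall>\<^sub>F q in at p within UNIV \<times> {0<..<T}. a < r q"
      using at_within_le_nhds filter_leD by blast
  qed
  have jets: "norm (grad_x \<phi> p) = eta_deriv \<delta> (inner_dist w p)"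
      "c - eta_deriv2 \<delta> (inner_dist w p) \<le> deriv_t \<phi> p - lap_x \<phi> p"
    if p: "snd p \<in> {0<..<T}" and touch: "touches_below p \<phi> r" for \<phi> p
  proof -
    have "\<forall>\<^sub>F q in nhds p. r p - \<phi> p \<le> r q - \<phi> q"
      using touch unfolding touches_below_def local_min_at_def by blast
    with near[OF p] have "\<forall>\<^sub>F q in nhds p. moving_profile \<delta> c w p - \<phi> p \<le> moving_profile \<delta> c w q - \<phi> q"
      by eventually_elim (simp add: r_eq[OF p] r_eq)
    then have "touches_below p \<phi> (moving_profile \<delta> c w)"
      using touch r_eq[OF p] unfolding touches_below_def local_min_at_def by simp
    then have jet: "lower_jet (moving_profile \<delta> c w) (fst p, snd p) (deriv_t \<phi> p) (grad_x \<phi> p) (hess_x \<phi> p)"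
      using lower_jet_touches_below[of p \<phi>] p by simp
    have "lap_x \<phi> p = (\<Sum>i\<in>UNIV. hess_x \<phi> p $ i $ i)"
      by (simp add: lap_x_def laplacian_def hess_x_def hessian_def)
    then show "norm (grad_x \<phi> p) = eta_deriv \<delta> (inner_dist w p)"
      "c - eta_deriv2 \<delta> (inner_dist w p) \<le> deriv_t \<phi> p - lap_x \<phi> p"
      using profile_jet[OF jet \<open>0 < \<delta>\<close>] p by auto
  qed
  obtain s0 :: real where s0: "s0 > 0" "\<And>e. 0 < e \<Longrightarrow> e < s0 \<Longrightarrow>
      1 / 2 \<le> (\<beta> / 2 - e) / (\<beta> / 2 + e) * (1 - 4 * \<alpha> * e / control_denom \<alpha> \<beta> e)"
    using control_coefficient_far[OF assms(2)] by blast
  \<comment> \<open>The first term is the bound needed to absorb \<open>\<eta>''\<close>. The second one forces \<open>exp (2 \<mu> s) < s0\<close>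
    for all \<open>s \<le> - \<delta> / 4\<close>.\<close>
  define \<mu>0 where "\<mu>0 = max (288 / (c * \<delta>\<^sup>2)) (2 * \<bar>ln s0\<bar> / \<delta>) + 1"
  have "0 \<le> 2 * \<bar>ln s0\<bar> / \<delta>"
    using \<open>0 < \<delta>\<close> by simp
  then have "\<mu>0 > 0"
    unfolding \<mu>0_def by linarith
  define \<epsilon>0 where "\<epsilon>0 = sqrt (\<alpha> + \<beta>) / \<mu>0"
  have "\<epsilon>0 > 0" using \<open>\<mu>0 > 0\<close> assms(1) by (simp add: \<epsilon>0_def)
  moreover have "LL_viscosity_supersolution \<alpha> \<beta> \<epsilon> T (control_map \<alpha> \<beta> k \<epsilon>) r
      (\<lambda>(x, t). control_map \<alpha> \<beta> k \<epsilon> (eta \<delta> (signed_dist w (x, t)) + c * t))"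
    if \<epsilon>: "0 < \<epsilon>" "\<epsilon> < \<epsilon>0" for \<epsilon>
  proof -
    define \<mu> where "\<mu> = sqrt (\<alpha> + \<beta>) / \<epsilon>"
    interpret global_control \<alpha> \<beta> \<epsilon> \<mu>
      by unfold_locales (use assms(1,2) \<epsilon>(1) in \<open>auto simp: \<mu>_def\<close>)
    have "\<mu> > \<mu>0"
      using \<epsilon> \<open>\<mu>0 > 0\<close> assms(1) by (simp add: \<mu>_def \<epsilon>0_def field_simps)
    then have \<mu>: "\<mu> \<ge> 288 / (c * \<delta>\<^sup>2)" "\<mu> > 2 * \<bar>ln s0\<bar> / \<delta>" "\<mu> > 0"
      using \<open>\<mu>0 > 0\<close> by (auto simp: \<mu>0_def)
    have E1: "E1_supersolution T (control_map \<alpha> \<beta> k \<epsilon>) r"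
      unfolding E1_supersolution_def Let_def control_map_meridian by simp
    have E2: "E2_supersolution \<alpha> \<beta> \<epsilon> T (control_map \<alpha> \<beta> k \<epsilon>) r"
      unfolding E2_supersolution_def Let_def
    proof (intro allI impI, rule E2_of_profile_inequality)
      fix \<phi> and p :: "(real^'n) \<times> real"
      assume "snd p \<in> {0<..<T} \<and> touches_below p \<phi> r"
      then have p: "snd p \<in> {0<..<T}" and touch: "touches_below p \<phi> r" by auto
      define d where "d = inner_dist w p"
      define s where "s = \<phi> p"
      define X where "X = - Sn s * (1 - 2 * \<gamma> * (Cs s)\<^sup>2) / Sp s"
      have "\<mu> * X * ((eta_deriv \<delta> d)\<^sup>2 - 1) \<le> c - eta_deriv2 \<delta> d"
      proof (cases "d \<le> \<delta> / 2")
        case True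
        have "s = eta \<delta> d + c * snd p"
          using touch r_eq[OF p] by (simp add: touches_below_def s_def d_def moving_profile_def)
        moreover have "c * snd p \<le> \<delta> / 4"
          using p \<open>c > 0\<close> by (simp flip: cT)
        ultimately have s: "s \<le> - \<delta> / 4"
          using eta_le_middle[OF \<open>0 < \<delta>\<close> True] by simp
        have "2 * \<mu> * s \<le> 2 * \<mu> * (- \<delta> / 4)"
          using s \<mu>(3) by (intro mult_left_mono) auto
        also have "\<dots> < - \<bar>ln s0\<bar>"
          using \<mu>(2) \<open>0 < \<delta>\<close> by (simp add: field_simps)
        also have "\<dots> \<le> ln s0" by simp
        finally have "exp (2 * \<mu> * s) < s0"
          using s0(1) by (metis exp_less_cancel_iff exp_ln)
        then have "1 / 2 \<le> X"
          unfolding X_def control_coefficient by (intro s0(2)) auto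
        moreover have "(eta_deriv \<delta> d)\<^sup>2 - 1 \<le> 0"
          using eta_deriv_nonneg[OF \<open>0 < \<delta>\<close>, of d] eta_deriv_le_1[OF \<open>0 < \<delta>\<close>, of d] by (simp add: power_le_one)
        ultimately have "\<mu> * X * ((eta_deriv \<delta> d)\<^sup>2 - 1) \<le> \<mu> * (1 / 2) * ((eta_deriv \<delta> d)\<^sup>2 - 1)"
          using \<mu>(3) by (intro mult_right_mono_neg mult_left_mono) auto
        also have "\<dots> \<le> c - eta_deriv2 \<delta> d"
          using eta_curvature_absorbed[OF \<open>0 < \<delta>\<close> \<open>c > 0\<close> \<mu>(1), of d] by (simp add: algebra_simps)
        finally show ?thesis .
      next
        case False
        then show ?thesis
          using \<open>c > 0\<close> \<open>0 < \<delta>\<close> by (simp add: eta_deriv_def eta_deriv2_def)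
      qed
      moreover have "- \<mu> * Sn s * (1 - 2 * \<gamma> * (Cs s)\<^sup>2) / Sp s = \<mu> * X"
        by (simp add: X_def)
      ultimately show "- \<mu> * Sn (\<phi> p) * (1 - 2 * \<gamma> * (Cs (\<phi> p))\<^sup>2) / Sp (\<phi> p) * ((norm (grad_x \<phi> p))\<^sup>2 - 1)
          \<le> deriv_t \<phi> p - lap_x \<phi> p"
        using jets[OF p touch] unfolding s_def[symmetric] d_def by simp
    qed
    show ?thesis
      unfolding LL_viscosity_supersolution_def
      using bdd lsc E1 E2 C2_control[of k] control_map_sphere[of k] by (auto simp: r_def)
  qed
  ultimately show ?thesis
    unfolding T_def[symmetric] c_def[symmetric] r_def[symmetric] by blast
qed

end
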